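(* Let $s\ge2$ be an integer and let $\lambda_s=\frac{\Gamma(1/s)^s}{s^s\, s!}$. Let $B$ be a fixed (deterministic) sequence of nonnegative integers with counting function $B(n)=|\{b\in B: b\le n\}|$ satisfying $$\liminf_{n\to\infty}\frac{B(n)}{\log n}<\lambda_s^{-1}.$$ Let $A$ be a random sequence of pseudo $s$-th powers. Then, almost surely, there are infinitely many integers $n$ that cannot be written in the form $$n=a_1+\cdots+a_s+b,\qquad \text{with pairwise distinct } a_1,\dots,a_s\in A \text{ and } b\in B.$$
   Context: A random sequence of pseudo $s$-th powers is defined as follows: on a probability space one takes independent Bernoulli random variables $(\xi_n)_{n\ge1}$ with $\mathbb P(\xi_n=1)=\frac1s n^{-1+1/s}$, and sets $A=\{n\ge1:\xi_n=1\}$. Thus the events $\{n\in A\}$ are independent and $\mathbb P(n\in A)=\frac1s n^{-1+1/s}$. *)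

theory Defs
  imports "HOL-Probability.Probability"
begin

definition lambda_const :: "nat \<Rightarrow> real" where
  "lambda_const s = Gamma (1 / real s) ^ s / (real s ^ s * fact s)"

definition counting_fun :: "nat set \<Rightarrow> nat \<Rightarrow> nat" where
  "counting_fun B n = card {b \<in> B. b \<le> n}"

text \<open>
  The values True and False of the Bernoulli variables play the roles of 1 and 0.
  For \<open>s \<ge> 2\<close> and \<open>n \<ge> 1\<close> the parameter lies in \<open>[0, 1]\<close>, so the
  clamping built into \<^const>\<open>bernoulli_pmf\<close> has no effect.
\<close>

definition (in prob_space) pseudo_power_vars :: "nat \<Rightarrow> (nat \<Rightarrow> 'a \<Rightarrow> bool) \<Rightarrow> bool" where
  "pseudo_power_vars s \<xi> \<longleftrightarrow>
     indep_vars (\<lambda>_. count_space UNIV) \<xi> {1..} \<and>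
     (\<forall>n\<ge>1. distr M (count_space UNIV) (\<xi> n) =
        measure_pmf (bernoulli_pmf (1 / real s * real n powr (- 1 + 1 / real s))))"

definition pseudo_powers :: "(nat \<Rightarrow> 'a \<Rightarrow> bool) \<Rightarrow> 'a \<Rightarrow> nat set" where
  "pseudo_powers \<xi> \<omega> = {n. n \<ge> 1 \<and> \<xi> n \<omega>}"

definition representable :: "nat \<Rightarrow> nat set \<Rightarrow> nat set \<Rightarrow> nat \<Rightarrow> bool" where
  "representable s A B n \<longleftrightarrow>
     (\<exists>a b. (\<forall>i\<in>{1..s}. a i \<in> A) \<and> inj_on a {1..s} \<and> b \<in> B \<and> n = (\<Sum>i=1..s. a i) + b)"

end

theory Submission
  imports Defs "HOL-Real_Asymp.Real_Asymp"
begin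

text \<open>
  Let \<open>c < 1 / \<lambda>\<close> and let \<open>N\<close> be one of the infinitely many integers with \<open>B(N) \<le> c ln N\<close>. An integer
  \<open>n \<le> N\<close> is not representable iff no \<open>s\<close>-subset of \<open>A\<close> has its sum in \<open>n - B\<close>. The expected number of
  such subsets is at most \<open>\<lambda> B(N) \<le> c \<lambda> ln N\<close>, so by the Harris inequality \<open>n\<close> fails to be representable
  with probability at least about \<open>N powr (- c \<lambda>)\<close>, and the expected number of failures up to \<open>N\<close>
  tends to infinity. Janson's inequality, applied to two shifted sets \<open>n - B\<close> and \<open>m - B\<close> that are disjoint and
  avoid small integers, shows that the two failures are asymptotically independent; only \<open>B(N)\<^sup>2\<close>
  many \<open>m\<close> are excluded for each \<open>n\<close>, and only few \<open>n\<close> have small elements in \<open>n - B\<close>. By Chebyshev's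
  inequality the probability that all \<open>n\<close> in \<open>(N\<^sub>0, N]\<close> are representable tends to \<open>0\<close> along these \<open>N\<close>.
\<close>

section \<open>Random subsets: Harris and Janson inequalities\<close>

text \<open>
  The expectation of \<open>f A\<close>, where \<open>A \<subseteq> {1..n}\<close> contains each \<open>i\<close> independently with probability \<open>p i\<close>.
\<close>

primrec bern_exp :: "(nat \<Rightarrow> real) \<Rightarrow> nat \<Rightarrow> (nat set \<Rightarrow> real) \<Rightarrow> real" where
  "bern_exp p 0 f = f {}"
| "bern_exp p (Suc n) f =
     (1 - p (Suc n)) * bern_exp p n f + p (Suc n) * bern_exp p n (\<lambda>A. f (insert (Suc n) A))"

lemma bern_exp_const [simp]: "bern_exp p n (\<lambda>_. c) = c"
  by (induction n) (auto simp: algebra_simps)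

lemma bern_exp_add: "bern_exp p n (\<lambda>A. f A + g A) = bern_exp p n f + bern_exp p n g"
  by (induction n arbitrary: f g) (auto simp: algebra_simps)

lemma bern_exp_cmult: "bern_exp p n (\<lambda>A. c * f A) = c * bern_exp p n f"
  by (induction n arbitrary: f) (auto simp: algebra_simps)

lemma bern_exp_uminus: "bern_exp p n (\<lambda>A. - f A) = - bern_exp p n f"
  using bern_exp_cmult[of p n "-1" f] by simp

lemma bern_exp_diff: "bern_exp p n (\<lambda>A. f A - g A) = bern_exp p n f - bern_exp p n g"
  using bern_exp_add[of p n f "\<lambda>A. - g A"] by (simp add: bern_exp_uminus)

lemma bern_exp_sum: "bern_exp p n (\<lambda>A. \<Sum>i\<in>I. f i A) = (\<Sum>i\<in>I. bern_exp p n (f i))"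
  by (induction I rule: infinite_finite_induct) (auto simp: bern_exp_add)

lemma bern_exp_cong:
  "(\<And>A. A \<subseteq> {1..n} \<Longrightarrow> f A = g A) \<Longrightarrow> bern_exp p n f = bern_exp p n g"
proof (induction n arbitrary: f g)
  case (Suc n)
  have "bern_exp p n f = bern_exp p n g"
    by (rule Suc.IH, rule Suc.prems) auto
  moreover have "bern_exp p n (\<lambda>A. f (insert (Suc n) A)) = bern_exp p n (\<lambda>A. g (insert (Suc n) A))"
    by (rule Suc.IH, rule Suc.prems) auto
  ultimately show ?case by simp
qed auto

text \<open>Identifies the recursion with integration against the product measure, splitting the
  subsets of \<open>{1..Suc n}\<close> by membership of \<open>Suc n\<close>. It serves the transfer
  to the probability space.\<close>

lemma bern_exp_eq_sum:
  "bern_exp p n f = (\<Sum>A\<in>Pow {1..n}. (\<Prod>i\<in>{1..n}. if i \<in> A then p i else 1 - p i) * f A)"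
proof (induction n arbitrary: f)
  case (Suc n)
  define w where "w k A = (\<Prod>i\<in>{1..k}. if i \<in> A then p i else 1 - p i)" for k :: nat and A
  have eq: "{1..Suc n} = insert (Suc n) {1..n}" by auto
  have w_out: "w (Suc n) A = (1 - p (Suc n)) * w n A" if "A \<in> Pow {1..n}" for A
  proof -
    have "Suc n \<notin> A" using that by auto
    then show ?thesis unfolding w_def eq by (subst prod.insert) auto
  qed
  have w_in: "w (Suc n) (insert (Suc n) A) = p (Suc n) * w n A" for A
    unfolding w_def eq by (subst prod.insert) (auto intro!: arg_cong2[where f="(*)"] prod.cong)
  have inj: "inj_on (insert (Suc n)) (Pow {1..n})"
  proof (rule inj_onI)
    fix A A' assume "A \<in> Pow {1..n}" "A' \<in> Pow {1..n}" "insert (Suc n) A = insert (Suc n) A'"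
    moreover from this have "Suc n \<notin> A" "Suc n \<notin> A'" by auto
    ultimately show "A = A'" by (simp add: insert_ident)
  qed
  have "(\<Sum>A\<in>Pow {1..Suc n}. w (Suc n) A * f A) =
      (\<Sum>A\<in>Pow {1..n}. w (Suc n) A * f A) + (\<Sum>A\<in>insert (Suc n) ` Pow {1..n}. w (Suc n) A * f A)"
    unfolding eq Pow_insert by (rule sum.union_disjoint) auto
  also have "\<dots> = (\<Sum>A\<in>Pow {1..n}. (1 - p (Suc n)) * (w n A * f A)) +
      (\<Sum>A\<in>Pow {1..n}. p (Suc n) * (w n A * f (insert (Suc n) A)))"
    using inj by (simp add: sum.reindex w_out w_in mult.assoc)
  also have "\<dots> = bern_exp p (Suc n) f"
    by (simp add: Suc.IH w_def sum_distrib_left)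
  finally show ?case by (simp add: w_def)
qed auto

definition depends_on :: "nat set \<Rightarrow> (nat set \<Rightarrow> real) \<Rightarrow> bool" where
  "depends_on U f \<longleftrightarrow> (\<forall>A. f A = f (A \<inter> U))"

text \<open>The element \<open>Suc n\<close> lies outside \<open>U\<close> or outside
  \<open>W\<close>, so at each step one of the two functions ignores it and its expectation can be
  pulled out of both branches of the recursion.\<close>

lemma bern_exp_indep:
  assumes "depends_on U f" "depends_on W g" "U \<inter> W = {}"
  shows "bern_exp p n (\<lambda>A. f A * g A) = bern_exp p n f * bern_exp p n g"
  using assms
proof (induction n arbitrary: f g)
  case (Suc n)
  have ins: "depends_on V (\<lambda>A. h (insert (Suc n) A))" if "depends_on V h" for V h
  proof -
    have "insert (Suc n) A \<inter> V = insert (Suc n) (A \<inter> V) \<inter> V" for A by auto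
    then show ?thesis using that unfolding depends_on_def by metis
  qed
  have out: "(\<lambda>A. h (insert (Suc n) A)) = h" if "depends_on V h" "Suc n \<notin> V" for V h
  proof
    fix A
    have "insert (Suc n) A \<inter> V = A \<inter> V" using that(2) by auto
    then show "h (insert (Suc n) A) = h A" using that(1) unfolding depends_on_def by metis
  qed
  have "Suc n \<notin> U \<or> Suc n \<notin> W" using Suc.prems by auto
  then have *: "(\<lambda>A. f (insert (Suc n) A)) = f \<or> (\<lambda>A. g (insert (Suc n) A)) = g"
    using out Suc.prems by blast
  note IH = Suc.IH[OF Suc.prems]
    Suc.IH[OF ins[OF Suc.prems(1)] ins[OF Suc.prems(2)] Suc.prems(3)]
  from * show ?case
    unfolding bern_exp.simps IH by (elim disjE) (simp_all add: algebra_simps)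
qed auto

section \<open>Correlation inequalities for monotone functions\<close>

locale bernoulli_weights =
  fixes p :: "nat \<Rightarrow> real"
  assumes p_nonneg: "0 \<le> p i" and p_le_1: "p i \<le> 1"
begin

lemma bern_exp_mono:
  "(\<And>A. A \<subseteq> {1..n} \<Longrightarrow> f A \<le> g A) \<Longrightarrow> bern_exp p n f \<le> bern_exp p n g"
proof (induction n arbitrary: f g)
  case (Suc n)
  have "bern_exp p n f \<le> bern_exp p n g"
    by (rule Suc.IH, rule Suc.prems) auto
  moreover have "bern_exp p n (\<lambda>A. f (insert (Suc n) A)) \<le> bern_exp p n (\<lambda>A. g (insert (Suc n) A))"
    by (rule Suc.IH, rule Suc.prems) auto
  ultimately show ?case
    using p_nonneg p_le_1 by (auto intro!: add_mono mult_left_mono)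
qed auto

lemma bern_exp_nonneg: "(\<And>A. f A \<ge> 0) \<Longrightarrow> bern_exp p n f \<ge> 0"
  using bern_exp_mono[of n "\<lambda>_. 0" f] by simp

text \<open>Induction over the coordinates. Conditioning on the last one leaves two averages for
  each function, and both pairs are ordered the same way.\<close>

lemma harris:
  assumes "mono f" "mono g"
  shows "bern_exp p n f * bern_exp p n g \<le> bern_exp p n (\<lambda>A. f A * g A)"
  using assms
proof (induction n arbitrary: f g)
  case (Suc n)
  let ?q = "p (Suc n)"
  let ?f = "\<lambda>A. f (insert (Suc n) A)" and ?g = "\<lambda>A. g (insert (Suc n) A)"
  define a b a' b' where ab: "a = bern_exp p n f" "b = bern_exp p n g"
    "a' = bern_exp p n ?f" "b' = bern_exp p n ?g"
  have m: "mono ?f" "mono ?g"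
    by (auto intro!: monoI monoD[OF Suc.prems(1)] monoD[OF Suc.prems(2)])
  have "a \<le> a'" "b \<le> b'"
    unfolding ab by (auto intro!: bern_exp_mono monoD[OF Suc.prems(1)] monoD[OF Suc.prems(2)])
  \<comment> \<open>This product is exactly the amount by which the mixture of the products
    \<open>a * b\<close> and \<open>a' * b'\<close> exceeds the product of the two mixtures.\<close>
  then have "0 \<le> ?q * (1 - ?q) * ((a' - a) * (b' - b))"
    using p_nonneg p_le_1 by (intro mult_nonneg_nonneg) auto
  then have "((1 - ?q) * a + ?q * a') * ((1 - ?q) * b + ?q * b')
      \<le> (1 - ?q) * (a * b) + ?q * (a' * b')"
    by (simp add: algebra_simps)
  also have "\<dots> \<le> (1 - ?q) * bern_exp p n (\<lambda>A. f A * g A) + ?q * bern_exp p n (\<lambda>A. ?f A * ?g A)"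
    unfolding ab using Suc.IH[OF Suc.prems] Suc.IH[OF m] p_nonneg p_le_1
    by (intro add_mono mult_left_mono) auto
  finally show ?case by (simp add: ab)
qed auto

lemma harris_mono_antimono:
  assumes "mono f" "antimono g"
  shows "bern_exp p n (\<lambda>A. f A * g A) \<le> bern_exp p n f * bern_exp p n g"
proof -
  have "mono (\<lambda>A. - g A)" using assms(2) by (auto simp: mono_def antimono_def)
  from harris[OF assms(1) this, of n] show ?thesis by (simp add: bern_exp_uminus)
qed

lemma harris_antimono:
  assumes "antimono f" "antimono g"
  shows "bern_exp p n f * bern_exp p n g \<le> bern_exp p n (\<lambda>A. f A * g A)"
proof -
  have "mono (\<lambda>A. - f A)" using assms(1) by (auto simp: mono_def antimono_def)
  from harris_mono_antimono[OF this assms(2), of n] show ?thesis by (simp add: bern_exp_uminus)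
qed

section \<open>Probability of avoiding a family of sets\<close>

definition weight :: "nat set \<Rightarrow> real" where
  "weight S = (\<Prod>a\<in>S. p a)"

lemma weight_nonneg: "0 \<le> weight S"
  unfolding weight_def by (intro prod_nonneg) (auto simp: p_nonneg)

lemma weight_le_1: "weight S \<le> 1"
  unfolding weight_def by (intro prod_le_1) (auto simp: p_nonneg p_le_1)

lemma bern_exp_subset:
  assumes "S \<subseteq> {1..n}"
  shows "bern_exp p n (\<lambda>A. of_bool (S \<subseteq> A)) = weight S"
  using assms
proof (induction n arbitrary: S)
  case 0
  then show ?case by (auto simp: weight_def)
next
  case (Suc n)
  show ?case
  proof (cases "Suc n \<in> S")
    case True
    have fin: "finite S" using Suc.prems finite_subset by blast
    have "bern_exp p n (\<lambda>A. of_bool (S \<subseteq> A)) = bern_exp p n (\<lambda>A. 0)"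
      using True by (intro bern_exp_cong) auto
    moreover have "bern_exp p n (\<lambda>A. of_bool (S \<subseteq> insert (Suc n) A)) =
        bern_exp p n (\<lambda>A. of_bool (S - {Suc n} \<subseteq> A))"
      by (intro bern_exp_cong) (auto simp: subset_insert_iff)
    moreover have "\<dots> = weight (S - {Suc n})"
      using Suc.prems by (intro Suc.IH) (auto simp: le_Suc_eq)
    moreover have "weight S = p (Suc n) * weight (S - {Suc n})"
      unfolding weight_def using True fin by (simp add: prod.remove)
    ultimately show ?thesis by simp
  next
    case False
    then have "(\<lambda>A. of_bool (S \<subseteq> insert (Suc n) A)) = (\<lambda>A. of_bool (S \<subseteq> A) :: real)"
      by (auto simp: fun_eq_iff subset_insert)
    moreover have "S \<subseteq> {1..n}" using False Suc.prems by (force simp: le_Suc_eq)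
    ultimately show ?thesis using Suc.IH[of S] by (simp add: algebra_simps)
  qed
qed

definition avoids :: "nat set set \<Rightarrow> nat set \<Rightarrow> real" where
  "avoids \<T> A = of_bool (\<forall>S\<in>\<T>. \<not> S \<subseteq> A)"

lemma avoids_nonneg: "0 \<le> avoids \<T> A"
  by (simp add: avoids_def)

lemma antimono_avoids: "antimono (avoids \<T>)"
  unfolding antimono_def avoids_def by (auto simp: of_bool_def)

lemma avoids_insert: "avoids (insert S \<T>) A = (1 - of_bool (S \<subseteq> A)) * avoids \<T> A"
  by (auto simp: avoids_def)

lemma avoids_Un: "avoids (\<S> \<union> \<T>) A = avoids \<S> A * avoids \<T> A"
  by (auto simp: avoids_def)

lemma depends_on_avoids:
  assumes "\<And>S. S \<in> \<T> \<Longrightarrow> S \<subseteq> U"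
  shows "depends_on U (avoids \<T>)"
  using assms by (simp add: depends_on_def avoids_def)

text \<open>By Harris the decreasing events \<open>\<not> S \<subseteq> A\<close> are positively
  correlated, so the probability is at least the product of the factors \<open>1 - weight S\<close>.
  Each factor is bounded by \<open>ln (1 - w) \<ge> - w - 2 * w ^ 2\<close>, valid for
  \<open>w \<le> 1 / 2\<close>.\<close>

lemma avoids_lower_bound:
  assumes "finite \<T>" "\<And>S. S \<in> \<T> \<Longrightarrow> S \<subseteq> {1..n}" "\<And>S. S \<in> \<T> \<Longrightarrow> weight S \<le> 1 / 2"
  shows "exp (- (\<Sum>S\<in>\<T>. weight S + 2 * weight S ^ 2)) \<le> bern_exp p n (avoids \<T>)"
  using assms
proof (induction \<T> rule: finite_induct)
  case empty
  then show ?case by (simp add: avoids_def[abs_def])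
next
  case (insert S \<T>)
  have w: "0 \<le> weight S" "weight S \<le> 1 / 2" using insert.prems weight_nonneg by auto
  have "exp (- (weight S + 2 * weight S ^ 2)) \<le> 1 - weight S"
    using ln_one_minus_pos_lower_bound[OF w] w by (subst ln_ge_iff[symmetric]) auto
  note le = mult_mono[OF this insert.IH]
  have "exp (- (\<Sum>S\<in>insert S \<T>. weight S + 2 * weight S ^ 2)) =
      exp (- (weight S + 2 * weight S ^ 2)) * exp (- (\<Sum>S\<in>\<T>. weight S + 2 * weight S ^ 2))"
    using insert.hyps by (simp add: mult_exp_exp)
  also have "\<dots> \<le> (1 - weight S) * bern_exp p n (avoids \<T>)"
    using insert.prems(1) insert.prems(2)[OF insertI2] w(2) by (intro le) simp_all
  also have "\<dots> = bern_exp p n (\<lambda>A. 1 - of_bool (S \<subseteq> A)) * bern_exp p n (avoids \<T>)"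
    using insert.prems bern_exp_subset[of S n] by (simp add: bern_exp_diff)
  also have "\<dots> \<le> bern_exp p n (\<lambda>A. (1 - of_bool (S \<subseteq> A)) * avoids \<T> A)"
    by (intro harris_antimono antimono_avoids) (auto simp: antimono_def of_bool_def)
  finally show ?case by (simp add: avoids_insert[abs_def])
qed

text \<open>Sets are added one at a time: the earlier sets split into \<open>D\<close>, those
  meeting the new set \<open>S\<close>, and \<open>I\<close>, which is independent of
  \<open>S\<close>. Avoiding \<open>S\<close> as well costs a factor of at most
  \<open>1 - q \<le> exp (- q)\<close>. The overlap term runs over ordered pairs, which is cruder
  than the classical exponent by a factor 2.\<close>

lemma janson:
  assumes "finite \<T>" "\<And>S. S \<in> \<T> \<Longrightarrow> S \<subseteq> {1..n}"
  shows "bern_exp p n (avoids \<T>) \<le>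
    exp (- (\<Sum>S\<in>\<T>. weight S) + (\<Sum>S\<in>\<T>. \<Sum>T\<in>{T\<in>\<T>. T \<noteq> S \<and> S \<inter> T \<noteq> {}}. weight (S \<union> T)))"
  using assms
proof (induction \<T> rule: finite_induct)
  case empty
  then show ?case by (simp add: avoids_def[abs_def])
next
  case (insert S \<T>)
  define D where "D = {T\<in>\<T>. S \<inter> T \<noteq> {}}"
  define I where "I = \<T> - D"
  \<comment> \<open>A lower bound for the conditional probability of \<open>S \<subseteq> A\<close>
    given that the earlier sets are avoided; the subtracted sum is a union bound over the sets that
    meet \<open>S\<close>.\<close>
  define q where "q = weight S - (\<Sum>T\<in>D. weight (S \<union> T))"
  let ?E = "bern_exp p n"
  have sub: "S \<subseteq> {1..n}" "\<And>T. T \<in> D \<Longrightarrow> T \<subseteq> {1..n}" "\<And>T. T \<in> \<T> \<Longrightarrow> T \<subseteq> {1..n}"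
    using insert.prems by (auto simp: D_def)
  have fin: "finite D" using insert.hyps by (simp add: D_def)
  have DI: "\<T> = D \<union> I" by (auto simp: D_def I_def)
  have E_I: "?E (\<lambda>A. of_bool (S \<subseteq> A) * avoids I A) = weight S * ?E (avoids I)"
  proof -
    have "depends_on S (\<lambda>A. of_bool (S \<subseteq> A))" by (auto simp: depends_on_def)
    moreover have "depends_on (- S) (avoids I)"
      by (rule depends_on_avoids) (auto simp: I_def D_def)
    ultimately show ?thesis
      using bern_exp_indep[of S _ "- S" "avoids I" p n] bern_exp_subset[OF sub(1)] by simp
  qed
  have E_T: "?E (\<lambda>A. of_bool (S \<union> T \<subseteq> A) * avoids I A) \<le> weight (S \<union> T) * ?E (avoids I)"
    if "T \<in> D" for T
  proof -
    have "mono (\<lambda>A. of_bool (S \<union> T \<subseteq> A) :: real)" by (auto simp: mono_def of_bool_def)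
    from harris_mono_antimono[OF this antimono_avoids, of n I] show ?thesis
      using bern_exp_subset[of "S \<union> T" n] sub(1) sub(2)[OF that] by simp
  qed
  have "q * ?E (avoids I) \<le> ?E (\<lambda>A. of_bool (S \<subseteq> A) * avoids I A) -
      (\<Sum>T\<in>D. ?E (\<lambda>A. of_bool (S \<union> T \<subseteq> A) * avoids I A))"
    unfolding q_def E_I left_diff_distrib sum_distrib_right
    by (intro diff_left_mono sum_mono E_T)
  also have "\<dots> = ?E (\<lambda>A. of_bool (S \<subseteq> A) * avoids I A -
      (\<Sum>T\<in>D. of_bool (S \<union> T \<subseteq> A) * avoids I A))"
    by (simp add: bern_exp_diff bern_exp_sum)
  also have "\<dots> \<le> ?E (\<lambda>A. of_bool (S \<subseteq> A) * avoids \<T> A)"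
  proof (rule bern_exp_mono)
    fix A
    show "of_bool (S \<subseteq> A) * avoids I A - (\<Sum>T\<in>D. of_bool (S \<union> T \<subseteq> A) * avoids I A)
        \<le> of_bool (S \<subseteq> A) * avoids \<T> A"
    \<comment> \<open>If some \<open>T\<close> in \<open>D\<close> lies in \<open>A\<close>, its
      term in the sum already cancels the first term; otherwise avoiding \<open>I\<close> is the
      same as avoiding the whole family.\<close>
    proof (cases "\<exists>T\<in>D. T \<subseteq> A")
      case True
      then obtain T where T: "T \<in> D" "T \<subseteq> A" by auto
      have "of_bool (S \<union> T \<subseteq> A) * avoids I A \<le> (\<Sum>T\<in>D. of_bool (S \<union> T \<subseteq> A) * avoids I A)"
        by (rule member_le_sum) (use T fin in \<open>auto simp: avoids_nonneg\<close>)
      moreover have "0 \<le> of_bool (S \<subseteq> A) * avoids \<T> A" by (simp add: avoids_nonneg)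
      ultimately show ?thesis using T by simp
    next
      case False
      then have "avoids \<T> A = avoids I A" unfolding DI avoids_Un by (simp add: avoids_def)
      moreover have "0 \<le> (\<Sum>T\<in>D. of_bool (S \<union> T \<subseteq> A) * avoids I A)"
        by (intro sum_nonneg) (auto simp: avoids_nonneg)
      ultimately show ?thesis by simp
    qed
  qed
  finally have *: "q * ?E (avoids I) \<le> ?E (\<lambda>A. of_bool (S \<subseteq> A) * avoids \<T> A)" .
  have "q * ?E (avoids \<T>) \<le> ?E (\<lambda>A. of_bool (S \<subseteq> A) * avoids \<T> A)"
  \<comment> \<open>Passing from \<open>I\<close> to the larger family lowers the left side only for
    nonnegative \<open>q\<close>; for negative \<open>q\<close> the left side is at most 0
    anyway.\<close>
  proof (cases "q \<ge> 0")
    case True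
    have "?E (avoids \<T>) \<le> ?E (avoids I)"
      by (rule bern_exp_mono) (auto simp: avoids_def I_def)
    then have "q * ?E (avoids \<T>) \<le> q * ?E (avoids I)" using True by (rule mult_left_mono)
    then show ?thesis using * by simp
  next
    case False
    have "q * ?E (avoids \<T>) \<le> 0"
      using False bern_exp_nonneg[of "avoids \<T>" n] avoids_nonneg by (simp add: mult_nonpos_nonneg)
    also have "0 \<le> ?E (\<lambda>A. of_bool (S \<subseteq> A) * avoids \<T> A)"
      by (rule bern_exp_nonneg) (simp add: avoids_nonneg)
    finally show ?thesis .
  qed
  then have "?E (avoids (insert S \<T>)) \<le> (1 - q) * ?E (avoids \<T>)"
    by (simp add: avoids_insert[abs_def] left_diff_distrib bern_exp_diff)
  also have "\<dots> \<le> exp (- q) * ?E (avoids \<T>)"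
    using exp_ge_add_one_self[of "- q"] bern_exp_nonneg[of "avoids \<T>" n] avoids_nonneg
    by (intro mult_right_mono) auto
  also have "\<dots> \<le> exp (- q) * exp (- (\<Sum>S\<in>\<T>. weight S) +
      (\<Sum>S\<in>\<T>. \<Sum>T\<in>{T\<in>\<T>. T \<noteq> S \<and> S \<inter> T \<noteq> {}}. weight (S \<union> T)))"
    using insert.IH[OF sub(3)] by (intro mult_left_mono) auto
  also have "\<dots> = exp (- (weight S + (\<Sum>S\<in>\<T>. weight S)) + ((\<Sum>T\<in>D. weight (S \<union> T)) +
      (\<Sum>S\<in>\<T>. \<Sum>T\<in>{T\<in>\<T>. T \<noteq> S \<and> S \<inter> T \<noteq> {}}. weight (S \<union> T))))"
    unfolding q_def by (simp add: mult_exp_exp)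
  also have "\<dots> \<le> exp (- (\<Sum>S\<in>insert S \<T>. weight S) +
      (\<Sum>S'\<in>insert S \<T>. \<Sum>T\<in>{T\<in>insert S \<T>. T \<noteq> S' \<and> S' \<inter> T \<noteq> {}}. weight (S' \<union> T)))"
  proof -
    have "{T\<in>insert S \<T>. T \<noteq> S \<and> S \<inter> T \<noteq> {}} = D" using insert.hyps by (auto simp: D_def)
    \<comment> \<open>The right side also counts the pairs with the new set in second position;
      these extra terms are nonnegative.\<close>
    moreover have "(\<Sum>S'\<in>\<T>. \<Sum>T\<in>{T\<in>\<T>. T \<noteq> S' \<and> S' \<inter> T \<noteq> {}}. weight (S' \<union> T))
        \<le> (\<Sum>S'\<in>\<T>. \<Sum>T\<in>{T\<in>insert S \<T>. T \<noteq> S' \<and> S' \<inter> T \<noteq> {}}. weight (S' \<union> T))"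
      using insert.hyps by (intro sum_mono sum_mono2) (auto simp: weight_nonneg)
    ultimately show ?thesis
      unfolding sum.insert[OF insert.hyps] by (simp only: exp_le_cancel_iff add_le_cancel_left)
  qed
  finally show ?case .
qed

end

section \<open>Weighted counts of representations\<close>

text \<open>
  The coefficients of \<open>(1 - z) powr (- b)\<close>. They majorise \<open>a powr (b - 1) / Gamma b\<close>, and since
  the \<open>s\<close>-th power of \<open>(1 - z) powr (- 1 / s)\<close> is \<open>1 / (1 - z)\<close>, they bound the expected number
  of representations by exactly \<open>lambda_const s\<close>.
\<close>

definition rising_coeff :: "real \<Rightarrow> nat \<Rightarrow> real" where
  "rising_coeff b n = pochhammer b n / fact n"

text \<open>The coefficientwise form of multiplying two of these power series, that is,
  Vandermonde's identity for rising factorials.\<close>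

lemma rising_coeff_add:
  "(\<Sum>i=0..n. rising_coeff b i * rising_coeff c (n - i)) = rising_coeff (b + c) n"
proof -
  have "rising_coeff b i * rising_coeff c (n - i) =
      of_nat (n choose i) * pochhammer b i * pochhammer c (n - i) / fact n" if "i \<in> {0..n}" for i
    using that by (simp add: rising_coeff_def binomial_fact)
  then have "(\<Sum>i=0..n. rising_coeff b i * rising_coeff c (n - i)) =
      (\<Sum>i=0..n. of_nat (n choose i) * pochhammer b i * pochhammer c (n - i) / fact n)"
    by (rule sum.cong[OF refl])
  also have "\<dots> = rising_coeff (b + c) n"
    by (simp add: rising_coeff_def pochhammer_binomial_sum sum_divide_distrib atMost_atLeast0)
  finally show ?thesis .
qed

lemma rising_coeff_0: "rising_coeff 0 n = of_bool (n = 0)"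
  by (simp add: rising_coeff_def pochhammer_0_left)

lemma rising_coeff_1: "rising_coeff 1 n = 1"
  by (simp add: rising_coeff_def flip: pochhammer_fact)

lemma rising_coeff_Suc: "rising_coeff b (Suc n) = rising_coeff b n * ((b + real n) / real (Suc n))"
  by (simp add: rising_coeff_def pochhammer_Suc field_simps)

lemma rising_coeff_nonneg: "0 \<le> b \<Longrightarrow> 0 \<le> rising_coeff b n"
  unfolding rising_coeff_def by (simp add: pochhammer_prod prod_nonneg)

lemma rising_coeff_mono: "0 \<le> b \<Longrightarrow> b \<le> c \<Longrightarrow> rising_coeff b n \<le> rising_coeff c n"
  unfolding rising_coeff_def pochhammer_prod by (intro divide_right_mono prod_mono) auto

text \<open>Consecutive coefficients have ratio \<open>1 - a / (n + 1)\<close>, which is at most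
  \<open>(1 + 1 / (n + 1)) powr (- a)\<close>; the product of these bounds telescopes.\<close>

lemma rising_coeff_upper:
  assumes "0 \<le> a" "a \<le> 1"
  shows "rising_coeff (1 - a) n \<le> real (Suc n) powr (- a)"
proof (induction n)
  case 0
  then show ?case by (simp add: rising_coeff_def)
next
  case (Suc n)
  let ?t = "1 / real (Suc n)"
  have "(1 - a + real n) / real (Suc n) = 1 - a * ?t" by (simp add: field_simps)
  also have "\<dots> \<le> exp (- (a * ?t))"
    using exp_ge_add_one_self[of "- (a * ?t)"] by simp
  also have "\<dots> \<le> exp (- (a * ln (1 + ?t)))"
    using assms mult_left_mono[OF ln_add_one_self_le_self[of ?t], of a] by simp
  also have "\<dots> = (1 + ?t) powr (- a)"
    using add_pos_pos[of 1 ?t] by (simp add: powr_def)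
  finally have "rising_coeff (1 - a) n * ((1 - a + real n) / real (Suc n)) \<le>
      real (Suc n) powr (- a) * (1 + ?t) powr (- a)"
    using Suc.IH assms by (intro mult_mono) (auto intro!: divide_nonneg_nonneg)
  also have "\<dots> = (real (Suc n) * (1 + ?t)) powr (- a)" by (simp add: powr_mult)
  also have "real (Suc n) * (1 + ?t) = real (Suc (Suc n))" by (simp add: field_simps)
  finally show ?case unfolding rising_coeff_Suc .
qed

text \<open>Log-convexity of Gamma, applied to \<open>n + 1\<close> as the convex combination of
  \<open>n + a\<close> and \<open>n + 1 + a\<close> with weights \<open>a\<close> and
  \<open>1 - a\<close>, gives
  \<open>Gamma (n + 1) \<le> Gamma (n + a) * (n + a) powr (1 - a)\<close>.\<close>

lemma powr_le_rising_coeff: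
  assumes a: "0 < a" "a < 1"
  shows "real (Suc n) powr (a - 1) \<le> Gamma a * rising_coeff a n"
proof -
  let ?n = "real n"
  have pos: "Gamma (?n + a) > 0" "Gamma (?n + 1 + a) > 0" "Gamma (?n + 1) > 0"
    using a by (auto intro!: Gamma_real_pos)
  have "ln (Gamma (a * (?n + a) + (1 - a) * (?n + 1 + a))) \<le>
      a * ln (Gamma (?n + a)) + (1 - a) * ln (Gamma (?n + 1 + a))"
    using convex_onD[OF log_convex_Gamma_real, of "1 - a" "?n + a" "?n + 1 + a"] a
    by simp
  moreover have "a * (?n + a) + (1 - a) * (?n + 1 + a) = ?n + 1" by (simp add: algebra_simps)
  moreover have G: "Gamma (?n + 1 + a) = (?n + a) * Gamma (?n + a)"
    using Gamma_plus1[of "?n + a"] a nonpos_Ints_nonpos[of "?n + a"] by (force simp: add_ac)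
  moreover have "ln ((?n + a) * Gamma (?n + a)) = ln (?n + a) + ln (Gamma (?n + a))"
    using a pos by (intro ln_mult_pos) auto
  ultimately have "ln (Gamma (?n + 1)) \<le>
      a * ln (Gamma (?n + a)) + (1 - a) * (ln (?n + a) + ln (Gamma (?n + a)))"
    by simp
  then have "ln (Gamma (?n + 1)) \<le> ln (Gamma (?n + a)) + (1 - a) * ln (?n + a)"
    by (simp add: algebra_simps)
  also have "\<dots> \<le> ln (Gamma (?n + a)) + (1 - a) * ln (?n + 1)"
    using a by (intro add_left_mono mult_left_mono) auto
  finally have "exp (ln (Gamma (?n + 1))) \<le> exp (ln (Gamma (?n + a)) + (1 - a) * ln (?n + 1))"
    by (simp only: exp_le_cancel_iff)
  then have "fact n \<le> Gamma (?n + a) * (?n + 1) powr (1 - a)"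
    using pos by (simp add: exp_add powr_def Gamma_fact add_ac)
  then have "fact n * (?n + 1) powr (a - 1) \<le>
      Gamma (?n + a) * (?n + 1) powr (1 - a) * (?n + 1) powr (a - 1)"
    by (rule mult_right_mono) simp
  also have "\<dots> = Gamma (?n + a)"
    by (simp add: mult.assoc flip: powr_add)
  also have "Gamma (?n + a) = Gamma a * pochhammer a n"
  proof -
    have "a \<notin> \<int>\<^sub>\<le>\<^sub>0" using a nonpos_Ints_nonpos[of a] by auto
    from pochhammer_Gamma[OF this, of n] show ?thesis
      using Gamma_real_pos[OF a(1)] by (simp add: add.commute)
  qed
  finally show ?thesis by (simp add: rising_coeff_def field_simps)
qed

section \<open>Weights of sets with prescribed size and sum\<close>

definition pseudo_prob :: "nat \<Rightarrow> nat \<Rightarrow> real" where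
  "pseudo_prob s n = 1 / real s * real n powr (- 1 + 1 / real s)"

locale pseudo_power =
  fixes s :: nat
  assumes s_ge_2: "s \<ge> 2"
begin

abbreviation p :: "nat \<Rightarrow> real" where "p \<equiv> pseudo_prob s"
abbreviation \<alpha> :: real where "\<alpha> \<equiv> 1 / real s"

lemma \<alpha>_pos: "0 < \<alpha>" and \<alpha>_le_half: "\<alpha> \<le> 1 / 2"
  using s_ge_2 by (auto simp: field_simps)

text \<open>By convention \<open>0 powr x = 0\<close>, so the index 0 carries no weight.\<close>

lemma p_0 [simp]: "p 0 = 0"
  by (simp add: pseudo_prob_def)

lemma p_le_half: "p n \<le> 1 / 2"
proof (cases "n = 0")
  case False
  have "real n powr (- 1 + \<alpha>) \<le> real n powr 0"
    using False \<alpha>_le_half by (intro powr_mono) auto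
  then have "\<alpha> * real n powr (- 1 + \<alpha>) \<le> \<alpha> * 1"
    using \<alpha>_pos False by (intro mult_left_mono) auto
  then show ?thesis using \<alpha>_le_half unfolding pseudo_prob_def by linarith
qed auto

sublocale bernoulli_weights p
proof
  show "0 \<le> p i" for i by (simp add: pseudo_prob_def)
  show "p i \<le> 1" for i using p_le_half[of i] by linarith
qed

text \<open>The coefficients of \<open>z ^ k * (1 - z) powr (- k / s)\<close>, the
  \<open>k\<close>-th power of the series for \<open>k = 1\<close>, which dominates \<open>p\<close>
  up to a constant. The shift by \<open>k\<close> reflects that every summand is at least 1.\<close>

definition coef :: "nat \<Rightarrow> nat \<Rightarrow> real" where
  "coef k x = (if x < k then 0 else rising_coeff (real k / real s) (x - k))"

lemma coef_nonneg: "0 \<le> coef k x"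
  by (simp add: coef_def rising_coeff_nonneg)

lemma coef_add: "(\<Sum>u\<le>x. coef j u * coef k (x - u)) = coef (j + k) x"
proof -
  have coef_fps: "Abs_fps (coef k) = fps_X ^ k * Abs_fps (rising_coeff (real k / real s))" for k
    by (rule fps_ext) (simp add: coef_def fps_X_power_mult_nth)
  have "Abs_fps (rising_coeff (real j / real s)) * Abs_fps (rising_coeff (real k / real s)) =
      Abs_fps (rising_coeff (real (j + k) / real s))"
    by (rule fps_ext) (simp add: fps_mult_nth rising_coeff_add add_divide_distrib)
  then have "Abs_fps (coef j) * Abs_fps (coef k) = Abs_fps (coef (j + k))"
    unfolding coef_fps power_add by (metis mult.assoc mult.left_commute)
  then have "fps_nth (Abs_fps (coef j) * Abs_fps (coef k)) x = coef (j + k) x" by simp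
  then show ?thesis by (simp add: fps_mult_nth atMost_atLeast0)
qed

text \<open>For \<open>k = s\<close> the series is \<open>z ^ s / (1 - z)\<close>. This exact bound
  is what makes the constant \<open>lambda_const s\<close> sharp enough.\<close>

lemma coef_s_le_1: "coef s x \<le> 1"
  using s_ge_2 by (simp add: coef_def rising_coeff_1)

text \<open>Since \<open>k < s\<close>, the parameter \<open>k / s\<close> is at most
  \<open>1 - \<alpha>\<close>, so the coefficients decay. Replacing \<open>m - k + 1\<close> by
  \<open>m\<close> costs at most a factor \<open>s powr \<alpha>\<close>, because
  \<open>m \<le> (m - k + 1) * k\<close>.\<close>

lemma coef_le:
  assumes "1 \<le> k" "k < s" "1 \<le> m"
  shows "coef k m \<le> real s * real m powr (- \<alpha>)"
proof (cases "m < k")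
  case True
  then show ?thesis by (simp add: coef_def)
next
  case False
  have "real k \<le> real s - 1" using assms by linarith
  then have "real k / real s \<le> 1 - \<alpha>" using s_ge_2 by (simp add: field_simps)
  then have "coef k m \<le> rising_coeff (1 - \<alpha>) (m - k)"
    using False by (simp add: coef_def rising_coeff_mono)
  also have "\<dots> \<le> real (Suc (m - k)) powr (- \<alpha>)"
    using \<alpha>_pos \<alpha>_le_half by (intro rising_coeff_upper) auto
  also have "\<dots> \<le> (real m / real s) powr (- \<alpha>)"
  proof (rule powr_mono2')
    have "m \<le> Suc (m - k) * k"
    proof -
      obtain d where "m = k + d" using False le_Suc_ex by (metis not_less)
      then show ?thesis using assms by (simp add: algebra_simps)
    qed
    also have "\<dots> \<le> Suc (m - k) * s" using assms by (intro mult_left_mono) auto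
    finally show "real m / real s \<le> real (Suc (m - k))"
      using s_ge_2 by (simp add: field_simps flip: of_nat_mult of_nat_Suc del: of_nat_Suc)
  qed (use assms s_ge_2 \<alpha>_pos in auto)
  also have "\<dots> = real s powr \<alpha> * real m powr (- \<alpha>)"
    using assms s_ge_2 by (simp add: powr_divide powr_minus field_simps)
  also have "\<dots> \<le> real s powr 1 * real m powr (- \<alpha>)"
    using s_ge_2 \<alpha>_le_half by (intro mult_right_mono powr_mono) auto
  finally show ?thesis using s_ge_2 by simp
qed

text \<open>Finiteness matters for \<open>k = 0\<close>: infinite sets have \<open>card\<close> and
  sum equal to 0.\<close>

definition summand_sets :: "nat \<Rightarrow> nat \<Rightarrow> nat set set" where
  "summand_sets k x = {S. finite S \<and> 0 \<notin> S \<and> card S = k \<and> \<Sum>S = x}"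

lemma summand_sets_subset: "S \<in> summand_sets k x \<Longrightarrow> S \<subseteq> {1..x}"
proof
  fix a assume "S \<in> summand_sets k x" "a \<in> S"
  then have "a \<le> \<Sum>S" "a \<noteq> 0" "\<Sum>S = x"
    using member_le_sum[of a S "\<lambda>a. a"] by (auto simp: summand_sets_def intro!: Nat.gr0I)
  then show "a \<in> {1..x}" by auto
qed

lemma finite_summand_sets [simp]: "finite (summand_sets k x)"
  by (rule finite_subset[of _ "Pow {1..x}"]) (use summand_sets_subset in blast)+

text \<open>The expected number of \<open>k\<close>-element subsets of the random set with sum
  \<open>x\<close>.\<close>

definition rep_weight :: "nat \<Rightarrow> nat \<Rightarrow> real" where
  "rep_weight k x = (\<Sum>S\<in>summand_sets k x. weight S)"

lemma rep_weight_nonneg: "0 \<le> rep_weight k x"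
  unfolding rep_weight_def by (intro sum_nonneg) (auto simp: weight_nonneg)

lemma summand_sets_0: "summand_sets 0 x = (if x = 0 then {{}} else {})"
  by (auto simp: summand_sets_def)

text \<open>Double counting of pairs of a set and one of its elements. It is only an inequality
  because the right side also allows \<open>a\<close> to repeat an element of the remaining
  set.\<close>

lemma rep_weight_Suc_le: "real (Suc k) * rep_weight (Suc k) x \<le> (\<Sum>a\<le>x. p a * rep_weight k (x - a))"
proof -
  have w: "weight S = p a * weight (S - {a})" if "S \<in> summand_sets (Suc k) x" "a \<in> S" for S a
    using that unfolding weight_def summand_sets_def by (auto simp: prod.remove)
  have "real (Suc k) * rep_weight (Suc k) x = (\<Sum>S\<in>summand_sets (Suc k) x. \<Sum>a\<in>S. weight S)"
    unfolding rep_weight_def sum_distrib_left by (intro sum.cong) (auto simp: summand_sets_def)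
  also have "\<dots> = (\<Sum>S\<in>summand_sets (Suc k) x. \<Sum>a\<in>S. p a * weight (S - {a}))"
    using w by (intro sum.cong refl) auto
  also have "\<dots> = (\<Sum>(S, a)\<in>Sigma (summand_sets (Suc k) x) (\<lambda>S. S). p a * weight (S - {a}))"
    by (rule sum.Sigma) (simp, simp add: summand_sets_def)
  also have "\<dots> \<le> (\<Sum>(a, S)\<in>Sigma {..x} (\<lambda>a. summand_sets k (x - a)). p a * weight S)"
  proof (rule sum_le_included[where i = "\<lambda>(a, S). (insert a S, a)"])
    show "finite (Sigma (summand_sets (Suc k) x) (\<lambda>S. S))"
      by (intro finite_SigmaI) (simp, simp add: summand_sets_def)
    show "\<forall>z\<in>Sigma (summand_sets (Suc k) x) (\<lambda>S. S). \<exists>y\<in>Sigma {..x} (\<lambda>a. summand_sets k (x - a)).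
        (case y of (a, S) \<Rightarrow> (insert a S, a)) = z \<and>
        (case z of (S, a) \<Rightarrow> p a * weight (S - {a})) \<le> (case y of (a, S) \<Rightarrow> p a * weight S)"
    proof clarify
      fix S a assume S: "S \<in> summand_sets (Suc k) x" "a \<in> S"
      have "x = a + \<Sum>(S - {a})" using S by (auto simp: summand_sets_def sum.remove)
      then have "S - {a} \<in> summand_sets k (x - a)" "a \<le> x" using S by (auto simp: summand_sets_def)
      then show "\<exists>y\<in>Sigma {..x} (\<lambda>a. summand_sets k (x - a)).
        (case y of (a, S) \<Rightarrow> (insert a S, a)) = (S, a) \<and>
        p a * weight (S - {a}) \<le> (case y of (a, S) \<Rightarrow> p a * weight S)"
        using S by (intro bexI[of _ "(a, S - {a})"]) auto
    qed
  qed (auto intro!: mult_nonneg_nonneg p_nonneg weight_nonneg)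
  also have "\<dots> = (\<Sum>a\<le>x. \<Sum>S\<in>summand_sets k (x - a). p a * weight S)"
    by (rule sum.Sigma[symmetric]) auto
  finally show ?thesis by (simp add: rep_weight_def sum_distrib_left)
qed

text \<open>The constant comparing \<open>p\<close> with \<open>coef 1\<close>; by definition
  \<open>C ^ s / fact s\<close> is \<open>lambda_const s\<close>.\<close>

definition C :: real where "C = Gamma \<alpha> / real s"

lemma C_nonneg: "0 \<le> C"
  unfolding C_def using \<alpha>_pos Gamma_real_pos[of \<alpha>] s_ge_2 by (intro divide_nonneg_nonneg) auto

lemma p_le_coef: "p a \<le> C * coef 1 a"
proof (cases a)
  case (Suc n)
  have "real (Suc n) powr (\<alpha> - 1) / real s \<le> Gamma \<alpha> * rising_coeff \<alpha> n / real s"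
    using \<alpha>_pos \<alpha>_le_half by (intro divide_right_mono powr_le_rising_coeff) auto
  then show ?thesis by (simp add: Suc pseudo_prob_def C_def coef_def)
qed (simp add: coef_def)

text \<open>Ordered tuples are counted by iterated convolution, and each unordered set arises from
  \<open>fact k\<close> of them. The convolutions of the majorants are evaluated exactly by
  \<open>coef_add\<close>.\<close>

lemma fact_rep_weight_le: "fact k * rep_weight k x \<le> C ^ k * coef k x"
proof (induction k arbitrary: x)
  case 0
  then show ?case by (simp add: rep_weight_def summand_sets_0 coef_def rising_coeff_0 weight_def)
next
  case (Suc k)
  have "fact (Suc k) * rep_weight (Suc k) x = fact k * (real (Suc k) * rep_weight (Suc k) x)" by simp
  also have "\<dots> \<le> fact k * (\<Sum>a\<le>x. p a * rep_weight k (x - a))"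
    by (intro mult_left_mono rep_weight_Suc_le) auto
  also have "\<dots> = (\<Sum>a\<le>x. p a * (fact k * rep_weight k (x - a)))"
    by (simp add: sum_distrib_left mult_ac)
  also have "\<dots> \<le> (\<Sum>a\<le>x. (C * coef 1 a) * (C ^ k * coef k (x - a)))"
    using rep_weight_nonneg C_nonneg coef_nonneg by (intro sum_mono mult_mono p_le_coef Suc.IH) auto
  also have "\<dots> = C ^ Suc k * (\<Sum>a\<le>x. coef 1 a * coef k (x - a))"
    by (simp add: sum_distrib_left mult_ac)
  also have "\<dots> = C ^ Suc k * coef (Suc k) x" by (simp add: coef_add)
  finally show ?case .
qed

lemma rep_weight_s_le: "rep_weight s x \<le> lambda_const s"
proof -
  have "fact s * rep_weight s x \<le> C ^ s * 1"
    using fact_rep_weight_le[of s x] mult_left_mono[OF coef_s_le_1, of "C ^ s" x] C_nonneg by auto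
  then show ?thesis
    using s_ge_2 by (simp add: lambda_const_def C_def power_divide field_simps)
qed

text \<open>A single crude constant that absorbs every power \<open>C ^ k\<close> with
  \<open>k \<le> s\<close> and the factor \<open>s\<close> of \<open>coef_le\<close>.\<close>

definition K :: real where "K = real s * max 1 C ^ s"

lemma K_ge_s: "real s \<le> K"
  unfolding K_def using mult_left_mono[of 1 "max 1 C ^ s" "real s"] by simp

lemma K_ge_1: "1 \<le> K"
  using K_ge_s s_ge_2 by linarith

lemma C_power_le: "k \<le> s \<Longrightarrow> C ^ k \<le> max 1 C ^ s"
proof -
  assume "k \<le> s"
  have "C ^ k \<le> max 1 C ^ k" using C_nonneg by (intro power_mono) auto
  also have "\<dots> \<le> max 1 C ^ s" using \<open>k \<le> s\<close> by (intro power_increasing) auto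
  finally show ?thesis .
qed

lemma rep_weight_le_coef: "rep_weight k x \<le> C ^ k * coef k x"
proof -
  have "rep_weight k x \<le> fact k * rep_weight k x"
    using mult_right_mono[OF fact_ge_1 rep_weight_nonneg[of k x], of k] by simp
  with fact_rep_weight_le show ?thesis by (rule order.trans[rotated])
qed

lemma rep_weight_0_right: "1 \<le> k \<Longrightarrow> rep_weight k 0 = 0"
  using rep_weight_le_coef[of k 0] rep_weight_nonneg[of k 0] by (simp add: coef_def)

lemma rep_weight_le_powr:
  assumes "1 \<le> k" "k < s"
  shows "rep_weight k m \<le> K * real m powr (- \<alpha>)"
\<comment> \<open>At \<open>m = 0\<close> the right side is 0 by the convention for
  \<open>powr\<close>, and the left side vanishes because \<open>k \<ge> 1\<close>.\<close>
proof (cases "m = 0")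
  case False
  have "rep_weight k m \<le> C ^ k * coef k m" by (rule rep_weight_le_coef)
  also have "\<dots> \<le> max 1 C ^ s * (real s * real m powr (- \<alpha>))"
    using assms False C_nonneg by (intro mult_mono C_power_le coef_le) (auto simp: coef_nonneg)
  finally show ?thesis by (simp add: K_def mult_ac)
qed (use assms in \<open>simp add: rep_weight_0_right\<close>)

lemma rep_weight_le_K:
  assumes "1 \<le> k" "k < s"
  shows "rep_weight k m \<le> K"
proof (cases "m = 0")
  case False
  have "real m powr (- \<alpha>) \<le> 1" using False \<alpha>_pos 
    by (simp add: powr_minus inverse_le_1_iff ge_one_powr_ge_zero)
  then show ?thesis using rep_weight_le_powr[OF assms, of m] mult_left_mono[of "real m powr (- \<alpha>)" 1 K] K_ge_1
    by linarith
qed (use assms K_ge_1 in \<open>simp add: rep_weight_0_right\<close>)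

text \<open>The majorants for \<open>j\<close> and \<open>s - j\<close> convolve to
  \<open>coef s\<close>, which is bounded by 1 uniformly in \<open>x\<close>.\<close>

lemma sum_rep_weight_mult_le:
  assumes "j \<le> s"
  shows "(\<Sum>u\<le>x. rep_weight j u * rep_weight (s - j) (x - u)) \<le> K"
proof -
  have "(\<Sum>u\<le>x. rep_weight j u * rep_weight (s - j) (x - u)) \<le> (\<Sum>u\<le>x. (C ^ j * coef j u) * (C ^ (s - j) * coef (s - j) (x - u)))"
    using C_nonneg by (intro sum_mono mult_mono rep_weight_le_coef) (auto simp: coef_nonneg rep_weight_nonneg)
  also have "\<dots> = C ^ j * C ^ (s - j) * (\<Sum>u\<le>x. coef j u * coef (s - j) (x - u))"
    by (simp add: sum_distrib_left mult_ac)
  also have "\<dots> = C ^ s * coef s x"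
    using assms by (simp add: coef_add flip: power_add)
  also have "\<dots> \<le> C ^ s * 1"
    using C_nonneg by (intro mult_left_mono coef_s_le_1) auto
  also have "\<dots> \<le> 1 * max 1 C ^ s" using C_power_le[of s] by simp
  also have "\<dots> \<le> K" unfolding K_def using s_ge_2 by (intro mult_right_mono) auto
  finally show ?thesis .
qed

lemma weight_le_half:
  assumes "S \<in> summand_sets s x"
  shows "weight S \<le> 1 / 2"
proof -
  from assms obtain a where "a \<in> S" "finite S" using s_ge_2 by (fastforce simp: summand_sets_def)
  then have "weight S = p a * weight (S - {a})" by (simp add: weight_def prod.remove)
  also have "\<dots> \<le> p a * 1" by (intro mult_left_mono weight_le_1 p_nonneg)
  finally show ?thesis using p_le_half[of a] by simp
qed

text \<open>Some element of \<open>S\<close> is at least \<open>x / s\<close>, and its probability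
  alone is small enough; \<open>- 1 + \<alpha> \<le> - \<alpha>\<close> because
  \<open>\<alpha> \<le> 1 / 2\<close>.\<close>

lemma weight_le_powr:
  assumes "S \<in> summand_sets s x" "1 \<le> x"
  shows "weight S \<le> K * real x powr (- \<alpha>)"
proof -
  have S: "finite S" "card S = s" "\<Sum>S = x" using assms by (auto simp: summand_sets_def)
  have "\<exists>a\<in>S. x \<le> s * a"
  proof (rule ccontr)
    assume "\<not> ?thesis"
    then have "(\<Sum>a\<in>S. s * a) < (\<Sum>a\<in>S. x)"
      using S s_ge_2 by (intro sum_strict_mono) auto
    then show False using S by (simp flip: sum_distrib_left)
  qed
  then obtain a where a: "a \<in> S" "x \<le> s * a" by auto
  then have a0: "a > 0" using assms(2) by (cases a) auto
  have "weight S = p a * weight (S - {a})" using a S by (simp add: weight_def prod.remove)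
  also have "\<dots> \<le> p a * 1" by (intro mult_left_mono weight_le_1 p_nonneg)
  also have "\<dots> \<le> 1 * real a powr (- 1 + \<alpha>)"
    unfolding pseudo_prob_def mult_1_right using \<alpha>_le_half by (intro mult_right_mono) auto
  also have "\<dots> \<le> real a powr (- \<alpha>)"
    unfolding mult_1 using a0 \<alpha>_le_half by (intro powr_mono) auto
  also have "\<dots> \<le> (real x / real s) powr (- \<alpha>)"
  proof (rule powr_mono2')
    have "real x \<le> real s * real a" using a(2) by (metis of_nat_le_iff of_nat_mult)
    then show "real x / real s \<le> real a" using s_ge_2 by (simp add: field_simps)
  qed (use assms s_ge_2 \<alpha>_pos in auto)
  also have "\<dots> = real s powr \<alpha> * real x powr (- \<alpha>)"
    using assms s_ge_2 by (simp add: powr_divide powr_minus field_simps)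
  also have "\<dots> \<le> real s powr 1 * real x powr (- \<alpha>)"
    using s_ge_2 \<alpha>_le_half by (intro mult_right_mono powr_mono) auto
  also have "\<dots> \<le> K * real x powr (- \<alpha>)"
    using K_ge_s s_ge_2 by (intro mult_right_mono) auto
  finally show ?thesis .
qed

end

section \<open>Pairs of overlapping representations\<close>

context pseudo_power begin

text \<open>The share of the targets \<open>x\<close> and \<open>y\<close> in the overlap term of
  Janson's inequality.\<close>

definition pair_weight :: "nat \<Rightarrow> nat \<Rightarrow> real" where
  "pair_weight x y = (\<Sum>S\<in>summand_sets s x. \<Sum>T\<in>{T\<in>summand_sets s y. T \<noteq> S \<and> S \<inter> T \<noteq> {}}. weight (S \<union> T))"

text \<open>Split a pair of sets into the common part, of size j and sum u, and the two differences.\<close>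

lemma pair_weight_le_sum:
  "pair_weight x y \<le> (\<Sum>j\<in>{1..<s}. \<Sum>u\<le>x. rep_weight j u * rep_weight (s - j) (x - u) * rep_weight (s - j) (y - u))"
proof -
  let ?P = "Sigma (summand_sets s x) (\<lambda>S. {T\<in>summand_sets s y. T \<noteq> S \<and> S \<inter> T \<noteq> {}})"
  let ?Q = "Sigma {1..<s} (\<lambda>j. Sigma {..x} (\<lambda>u. summand_sets j u \<times> summand_sets (s - j) (x - u) \<times> summand_sets (s - j) (y - u)))"
  let ?f = "\<lambda>(j::nat, u::nat, U, V, W). weight U * weight V * weight W"
  have fin: "finite ?Q" by (intro finite_SigmaI) auto
  have "pair_weight x y = (\<Sum>(S, T)\<in>?P. weight (S \<union> T))"
    unfolding pair_weight_def by (rule sum.Sigma) auto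
  also have "\<dots> \<le> (\<Sum>z\<in>?Q. ?f z)"
  proof (rule sum_le_included[where i = "\<lambda>(j, u, U, V, W). (U \<union> V, U \<union> W)"])
    show "finite ?P" by (intro finite_SigmaI) auto
    show "\<forall>z\<in>?Q. 0 \<le> ?f z" by (auto intro!: mult_nonneg_nonneg weight_nonneg)
    show "\<forall>z\<in>?P. \<exists>q\<in>?Q. (case q of (j, u, U, V, W) \<Rightarrow> (U \<union> V, U \<union> W)) = z \<and>
        (case z of (S, T) \<Rightarrow> weight (S \<union> T)) \<le> ?f q"
    proof clarify
      fix S T assume S: "S \<in> summand_sets s x" and T: "T \<in> summand_sets s y" and ne: "T \<noteq> S" "S \<inter> T \<noteq> {}"
      define U where "U = S \<inter> T"
      have fin: "finite S" "finite T" "finite U" and card: "card S = s" "card T = s"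
        and sum: "\<Sum>S = x" "\<Sum>T = y" and z: "0 \<notin> S" "0 \<notin> T"
        using S T by (auto simp: summand_sets_def U_def)
      have U: "U \<subseteq> S" "U \<subseteq> T" "U \<noteq> {}" using ne by (auto simp: U_def)
      \<comment> \<open>Both sets have \<open>s\<close> elements, so a common part of size
        \<open>s\<close> would make them equal. Hence both differences are nonempty and the decay
        bounds for fewer than \<open>s\<close> summands apply.\<close>
      have "card U \<noteq> s"
      proof
        assume "card U = s"
        then have "U = S" "U = T" using card_subset_eq[of S U] card_subset_eq[of T U] fin U card by auto
        then show False using ne by simp
      qed
      moreover have "card U \<le> s" using card_mono[OF fin(1) U(1)] card by simp
      moreover have "card U \<ge> 1" using U fin by (simp add: Suc_le_eq card_gt_0_iff)
      ultimately have j: "card U \<in> {1..<s}" by auto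
      have "x = \<Sum>U + \<Sum>(S - U)" "y = \<Sum>U + \<Sum>(T - U)"
        using sum.subset_diff[OF U(1) fin(1), of "\<lambda>a. a"] sum.subset_diff[OF U(2) fin(2), of "\<lambda>a. a"] sum
        by auto
      then have "U \<in> summand_sets (card U) (\<Sum>U)" "S - U \<in> summand_sets (s - card U) (x - \<Sum>U)"
        "T - U \<in> summand_sets (s - card U) (y - \<Sum>U)" "\<Sum>U \<le> x"
        using fin card U z by (auto simp: summand_sets_def card_Diff_subset)
      moreover have "weight (S \<union> T) = weight U * weight (S - U) * weight (T - U)"
      proof -
        have "S \<union> T = (U \<union> (S - U)) \<union> (T - U)" using U by auto
        then show ?thesis unfolding weight_def
          using fin by (subst prod.union_disjoint[symmetric], auto simp: U_def)+
      qed
      moreover have "(U \<union> (S - U), U \<union> (T - U)) = (S, T)" using U by auto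
      ultimately show "\<exists>q\<in>?Q. (case q of (j, u, U, V, W) \<Rightarrow> (U \<union> V, U \<union> W)) = (S, T) \<and>
          weight (S \<union> T) \<le> ?f q"
        using j by (intro bexI[of _ "(card U, \<Sum>U, U, S - U, T - U)"]) auto
    qed
  qed (use fin in auto)
  also have "\<dots> = (\<Sum>j\<in>{1..<s}. \<Sum>z\<in>Sigma {..x} (\<lambda>u. summand_sets j u \<times> summand_sets (s - j) (x - u) \<times> summand_sets (s - j) (y - u)).
      case z of (u, U, V, W) \<Rightarrow> weight U * weight V * weight W)"
    by (subst sum.Sigma) (auto intro!: finite_SigmaI)
  also have "\<dots> = (\<Sum>j\<in>{1..<s}. \<Sum>u\<le>x. \<Sum>z\<in>summand_sets j u \<times> summand_sets (s - j) (x - u) \<times> summand_sets (s - j) (y - u).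
      case z of (U, V, W) \<Rightarrow> weight U * weight V * weight W)"
    by (intro sum.cong refl, subst sum.Sigma) (auto intro!: finite_SigmaI)
  also have "\<dots> = (\<Sum>j\<in>{1..<s}. \<Sum>u\<le>x. rep_weight j u * rep_weight (s - j) (x - u) * rep_weight (s - j) (y - u))"
    unfolding rep_weight_def
    by (intro sum.cong refl)
      (simp add: mult.assoc flip: sum.cartesian_product sum_distrib_left sum_distrib_right)
  finally show ?thesis .
qed

text \<open>The sum over \<open>u\<close> is cut at distance \<open>w\<close> below
  \<open>y\<close>. If \<open>y - u \<ge> w\<close>, the third factor is small and the other two sum
  to at most \<open>K\<close>. If \<open>0 < y - u < w\<close>, then \<open>u\<close> is large, so
  the first factor is small, and there are fewer than \<open>w\<close> such
  \<open>u\<close>.\<close>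

lemma pair_weight_le:
  assumes "1 \<le> w" "w < y"
  shows "pair_weight x y \<le> real s * (K ^ 2 * real w powr (- \<alpha>) + K ^ 3 * real w * real (y - w) powr (- \<alpha>))"
proof -
  define t1 t2 where "t1 = K * real w powr (- \<alpha>)" and "t2 = K ^ 3 * real (y - w) powr (- \<alpha>)"
  have K0: "0 \<le> K" using K_ge_1 by linarith
  have t: "0 \<le> t1" "0 \<le> t2" using K0 by (auto simp: t1_def t2_def)
  have inner: "(\<Sum>u\<le>x. rep_weight j u * rep_weight (s - j) (x - u) * rep_weight (s - j) (y - u)) \<le> K * t1 + real w * t2"
    if j: "j \<in> {1..<s}" for j
  proof -
    have j': "1 \<le> j" "j < s" "1 \<le> s - j" "s - j < s" using j by auto
    have "rep_weight j u * rep_weight (s - j) (x - u) * rep_weight (s - j) (y - u) \<le>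
        rep_weight j u * rep_weight (s - j) (x - u) * t1 + (if u \<in> {y - w<..<y} then t2 else 0)" for u
    proof (cases "y - w < u \<and> u < y")
      case True
      have "rep_weight j u * rep_weight (s - j) (x - u) * rep_weight (s - j) (y - u) \<le> (K * real u powr (- \<alpha>)) * K * K"
        using K0 j' by (intro mult_mono rep_weight_le_powr rep_weight_le_K) (auto simp: rep_weight_nonneg)
      also have "\<dots> = K ^ 3 * real u powr (- \<alpha>)" by (simp add: power3_eq_cube)
      also have "\<dots> \<le> t2"
        unfolding t2_def using K0 True assms \<alpha>_pos by (intro mult_left_mono powr_mono2') auto
      finally show ?thesis using True t by (simp add: rep_weight_nonneg add_increasing)
    next
      case False
      have "rep_weight (s - j) (y - u) \<le> t1"
      proof (cases "u < y")
        case True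
        have "rep_weight (s - j) (y - u) \<le> K * real (y - u) powr (- \<alpha>)" by (intro rep_weight_le_powr j')
        also have "\<dots> \<le> t1"
          unfolding t1_def using K0 True False assms \<alpha>_pos by (intro mult_left_mono powr_mono2') auto
        finally show ?thesis .
      next
        case False
        \<comment> \<open>Here truncated subtraction gives \<open>y - u = 0\<close>, and 0 is not a
          sum of positive integers.\<close>
        then show ?thesis using j' t by (simp add: rep_weight_0_right)
      qed
      then have "rep_weight j u * rep_weight (s - j) (x - u) * rep_weight (s - j) (y - u) \<le> rep_weight j u * rep_weight (s - j) (x - u) * t1"
        by (intro mult_left_mono) (auto simp: rep_weight_nonneg)
      then show ?thesis using t by simp
    qed
    then have "(\<Sum>u\<le>x. rep_weight j u * rep_weight (s - j) (x - u) * rep_weight (s - j) (y - u)) \<le>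
        (\<Sum>u\<le>x. rep_weight j u * rep_weight (s - j) (x - u)) * t1 + (\<Sum>u\<le>x. if u \<in> {y - w<..<y} then t2 else 0)"
      unfolding sum_distrib_right sum.distrib[symmetric] by (intro sum_mono) auto
    also have "(\<Sum>u\<le>x. rep_weight j u * rep_weight (s - j) (x - u)) * t1 \<le> K * t1"
      using j' t by (intro mult_right_mono sum_rep_weight_mult_le) auto
    also have "(\<Sum>u\<le>x. if u \<in> {y - w<..<y} then t2 else 0) = real (card ({..x} \<inter> {y - w<..<y})) * t2"
      by (subst sum.inter_restrict[symmetric]) auto
    also have "\<dots> \<le> real w * t2"
    proof (intro mult_right_mono t)
      have "card ({..x} \<inter> {y - w<..<y}) \<le> card {y - w<..<y}" by (intro card_mono) auto
      also have "\<dots> \<le> w" by simp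
      finally show "real (card ({..x} \<inter> {y - w<..<y})) \<le> real w" by simp
    qed
    finally show ?thesis by simp
  qed
  have "pair_weight x y \<le> (\<Sum>j\<in>{1..<s}. K * t1 + real w * t2)"
    by (rule order.trans[OF pair_weight_le_sum]) (intro sum_mono inner)
  also have "\<dots> = real (s - 1) * (K * t1 + real w * t2)" by simp
  also have "\<dots> \<le> real s * (K * t1 + real w * t2)"
    using t K0 by (intro mult_right_mono) auto
  finally show ?thesis by (simp add: t1_def t2_def power2_eq_square mult_ac)
qed

end

section \<open>The second moment\<close>

text \<open>Chebyshev's inequality for the sum \<open>X\<close> of the indicators with mean
  \<open>Q\<close>: where \<open>X = 0\<close>, the square \<open>(X - Q) ^ 2\<close> equals
  \<open>Q ^ 2\<close>. Pairs related by \<open>r\<close> are bounded trivially by one of their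
  means and contribute at most \<open>D * Q\<close> in total.\<close>

lemma (in bernoulli_weights) second_moment:
  assumes fin: "finite G"
    and f01: "\<And>i A. f i A = 0 \<or> f i A = (1 :: real)"
    and pair: "\<And>i j. i \<in> G \<Longrightarrow> j \<in> G \<Longrightarrow> \<not> r i j \<Longrightarrow>
      bern_exp p n (\<lambda>A. f i A * f j A) \<le> (1 + \<epsilon>) * (bern_exp p n (f i) * bern_exp p n (f j))"
    and r: "\<And>i. i \<in> G \<Longrightarrow> real (card {j\<in>G. r i j}) \<le> D"
    and \<epsilon>: "0 \<le> \<epsilon>"
    and Q: "0 < (\<Sum>i\<in>G. bern_exp p n (f i))"
  shows "bern_exp p n (\<lambda>A. of_bool (\<forall>i\<in>G. f i A = 0)) \<le> D / (\<Sum>i\<in>G. bern_exp p n (f i)) + \<epsilon>"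
proof -
  let ?E = "bern_exp p n"
  define Q where "Q = (\<Sum>i\<in>G. ?E (f i))"
  define X where "X A = (\<Sum>i\<in>G. f i A)" for A
  have f_nonneg: "0 \<le> f i A" and f_le: "f i A * f j A \<le> f i A" for i j A
    using f01[of i A] f01[of j A] by auto
  have q_nonneg: "0 \<le> ?E (f i)" for i by (rule bern_exp_nonneg) (rule f_nonneg)
  have EX: "?E X = Q" by (simp add: X_def[abs_def] Q_def bern_exp_sum)
  have pair': "?E (\<lambda>A. f i A * f j A) \<le>
      (1 + \<epsilon>) * (?E (f i) * ?E (f j)) + (if r i j then ?E (f i) else 0)" if "i \<in> G" "j \<in> G" for i j
  proof (cases "r i j")
    case True
    have "?E (\<lambda>A. f i A * f j A) \<le> ?E (f i)" by (rule bern_exp_mono) (rule f_le)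
    then show ?thesis using True q_nonneg \<epsilon> by (simp add: add_increasing)
  next
    case False
    then show ?thesis using pair[OF that] by simp
  qed
  have "?E (\<lambda>A. X A ^ 2) = (\<Sum>i\<in>G. \<Sum>j\<in>G. ?E (\<lambda>A. f i A * f j A))"
    by (simp add: X_def power2_eq_square sum_product bern_exp_sum)
  also have "\<dots> \<le> (\<Sum>i\<in>G. \<Sum>j\<in>G. (1 + \<epsilon>) * (?E (f i) * ?E (f j)) + (if r i j then ?E (f i) else 0))"
    by (intro sum_mono pair')
  also have "\<dots> = (1 + \<epsilon>) * Q ^ 2 + (\<Sum>i\<in>G. real (card {j\<in>G. r i j}) * ?E (f i))"
  proof -
    have "(1 + \<epsilon>) * Q ^ 2 = (\<Sum>i\<in>G. \<Sum>j\<in>G. (1 + \<epsilon>) * (?E (f i) * ?E (f j)))"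
      by (simp add: Q_def power2_eq_square sum_product flip: sum_distrib_left)
    moreover have "(\<Sum>j\<in>G. if r i j then ?E (f i) else 0) = real (card {j\<in>G. r i j}) * ?E (f i)" for i
      using fin by (simp flip: sum.inter_filter)
    ultimately show ?thesis by (simp add: sum.distrib)
  qed
  also have "(\<Sum>i\<in>G. real (card {j\<in>G. r i j}) * ?E (f i)) \<le> (\<Sum>i\<in>G. D * ?E (f i))"
    by (intro sum_mono mult_right_mono r q_nonneg)
  also have "\<dots> = D * Q" by (simp add: Q_def sum_distrib_left)
  finally have EX2: "?E (\<lambda>A. X A ^ 2) \<le> (1 + \<epsilon>) * Q ^ 2 + D * Q" by simp
  have "Q ^ 2 * ?E (\<lambda>A. of_bool (\<forall>i\<in>G. f i A = 0)) = ?E (\<lambda>A. Q ^ 2 * of_bool (\<forall>i\<in>G. f i A = 0))"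
    by (simp add: bern_exp_cmult)
  also have "\<dots> \<le> ?E (\<lambda>A. (X A - Q) ^ 2)"
    by (rule bern_exp_mono) (auto simp: X_def)
  also have "\<dots> = ?E (\<lambda>A. X A ^ 2 - 2 * Q * X A + Q ^ 2)"
    by (simp add: power2_eq_square algebra_simps)
  also have "\<dots> = ?E (\<lambda>A. X A ^ 2) - Q ^ 2"
    by (simp add: bern_exp_add bern_exp_diff bern_exp_cmult EX power2_eq_square)
  also have "\<dots> \<le> Q ^ 2 * \<epsilon> + D * Q" using EX2 by (simp add: algebra_simps)
  also have "\<dots> = Q ^ 2 * (D / Q + \<epsilon>)"
    using Q by (simp add: Q_def[symmetric] power2_eq_square field_simps)
  finally show ?thesis
    using Q by (simp add: Q_def[symmetric] mult_le_cancel_left)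
qed

section \<open>Avoiding all sums in a given set of targets\<close>

context pseudo_power begin

definition sum_sets :: "nat set \<Rightarrow> nat set set" where
  "sum_sets Z = (\<Union>x\<in>Z. summand_sets s x)"

lemma sum_sum_sets:
  assumes "finite Z"
  shows "(\<Sum>S\<in>{S\<in>sum_sets Z. P S}. f S) = (\<Sum>x\<in>Z. \<Sum>S\<in>{S\<in>summand_sets s x. P S}. f S)"
proof -
  have "{S\<in>sum_sets Z. P S} = (\<Union>x\<in>Z. {S\<in>summand_sets s x. P S})" by (auto simp: sum_sets_def)
  then show ?thesis
    using assms by (simp, intro sum.UNION_disjoint) (simp, simp, force simp: summand_sets_def)
qed

lemma sum_sets_Un: "sum_sets (Y \<union> Z) = sum_sets Y \<union> sum_sets Z"
  by (auto simp: sum_sets_def)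

lemma sum_sets_subset: "Z \<subseteq> {..n} \<Longrightarrow> S \<in> sum_sets Z \<Longrightarrow> S \<subseteq> {1..n}"
  using summand_sets_subset by (fastforce simp: sum_sets_def)

definition mean :: "nat set \<Rightarrow> real" where
  "mean Z = (\<Sum>x\<in>Z. rep_weight s x)"

lemma mean_le: "mean Z \<le> lambda_const s * real (card Z)"
  unfolding mean_def using sum_mono[of Z "rep_weight s" "\<lambda>_. lambda_const s"] rep_weight_s_le by (simp add: mult.commute)

text \<open>Large targets force small weights, so each squared weight is at most
  \<open>\<eta>\<close> times the weight and the quadratic correction becomes a small multiple of
  the mean.\<close>

lemma avoids_sum_sets_lower:
  assumes Z: "Z \<subseteq> {..n}" and \<eta>: "\<And>x. x \<in> Z \<Longrightarrow> 1 \<le> x \<and> K * real x powr (- \<alpha>) \<le> \<eta>" "0 \<le> \<eta>"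
  shows "exp (- mean Z - 2 * \<eta> * (lambda_const s * real (card Z))) \<le> bern_exp p n (avoids (sum_sets Z))"
proof -
  have fin: "finite Z" using Z finite_subset by blast
  have m: "(\<Sum>S\<in>sum_sets Z. weight S) = mean Z"
    using sum_sum_sets[OF fin, where P = "\<lambda>_. True" and f = weight] by (simp add: mean_def rep_weight_def)
  have le: "weight S + 2 * weight S ^ 2 \<le> weight S + 2 * \<eta> * weight S" if S: "S \<in> sum_sets Z" for S
  proof -
    obtain x where x: "x \<in> Z" "S \<in> summand_sets s x" using S by (auto simp: sum_sets_def)
    have "weight S \<le> \<eta>" using weight_le_powr[OF x(2)] \<eta>(1)[OF x(1)] by linarith
    then have "weight S * weight S \<le> \<eta> * weight S"
      by (intro mult_right_mono weight_nonneg)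
    then show ?thesis by (simp add: power2_eq_square)
  qed
  have "(\<Sum>S\<in>sum_sets Z. weight S + 2 * weight S ^ 2) \<le> (\<Sum>S\<in>sum_sets Z. weight S + 2 * \<eta> * weight S)"
    by (intro sum_mono le)
  also have "\<dots> = mean Z + 2 * \<eta> * mean Z"
    by (simp add: sum.distrib m flip: sum_distrib_left)
  also have "\<dots> \<le> mean Z + 2 * \<eta> * (lambda_const s * real (card Z))"
    using \<eta>(2) by (intro add_left_mono mult_left_mono mean_le) auto
  finally have "exp (- mean Z - 2 * \<eta> * (lambda_const s * real (card Z))) \<le>
      exp (- (\<Sum>S\<in>sum_sets Z. weight S + 2 * weight S ^ 2))" by simp
  also have "\<dots> \<le> bern_exp p n (avoids (sum_sets Z))"
    using fin Z weight_le_half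
    by (intro avoids_lower_bound sum_sets_subset) (auto simp: sum_sets_def)
  finally show ?thesis .
qed

text \<open>Janson's inequality with the overlapping pairs grouped according to their two
  sums.\<close>

lemma avoids_sum_sets_upper:
  assumes Z: "Z \<subseteq> {..n}"
  shows "bern_exp p n (avoids (sum_sets Z)) \<le> exp (- mean Z + (\<Sum>x\<in>Z. \<Sum>y\<in>Z. pair_weight x y))"
proof -
  have fin: "finite Z" using Z finite_subset by blast
  have m: "(\<Sum>S\<in>sum_sets Z. f S) = (\<Sum>x\<in>Z. \<Sum>S\<in>summand_sets s x. f S)" for f :: "nat set \<Rightarrow> real"
    using sum_sum_sets[OF fin, where P = "\<lambda>_. True" and f = f] by simp
  have "(\<Sum>S\<in>sum_sets Z. \<Sum>T\<in>{T\<in>sum_sets Z. T \<noteq> S \<and> S \<inter> T \<noteq> {}}. weight (S \<union> T)) =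
      (\<Sum>x\<in>Z. \<Sum>y\<in>Z. pair_weight x y)"
    unfolding m sum_sum_sets[OF fin] pair_weight_def by (intro sum.cong refl sum.swap)
  moreover have "(\<Sum>S\<in>sum_sets Z. weight S) = mean Z" by (simp add: m mean_def rep_weight_def)
  moreover have "finite (sum_sets Z)" using fin by (simp add: sum_sets_def)
  ultimately show ?thesis
    using janson[of "sum_sets Z" n] sum_sets_subset[OF Z] by simp
qed

text \<open>The set \<open>n - B\<close>. The condition \<open>b \<le> n\<close> keeps truncated
  subtraction from producing a spurious 0 and makes the map injective.\<close>

definition shifts :: "nat set \<Rightarrow> nat \<Rightarrow> nat set" where
  "shifts B n = (\<lambda>b. n - b) ` {b\<in>B. b \<le> n}"

lemma shifts_subset: "shifts B n \<subseteq> {..n}"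
  by (auto simp: shifts_def)

lemma card_shifts: "card (shifts B n) = counting_fun B n"
  unfolding shifts_def counting_fun_def by (intro card_image) (auto simp: inj_on_def)

lemma counting_fun_mono: "m \<le> n \<Longrightarrow> counting_fun B m \<le> counting_fun B n"
  unfolding counting_fun_def by (intro card_mono) auto

text \<open>Injective families indexed by \<open>{1..s}\<close> correspond to sets of size
  \<open>s\<close>. The hypothesis on 0 matches its exclusion from
  \<open>summand_sets\<close>.\<close>

lemma avoids_shifts:
  assumes "0 \<notin> A"
  shows "avoids (sum_sets (shifts B n)) A = of_bool (\<not> representable s A B n)"
proof -
  have "(\<exists>S\<in>sum_sets (shifts B n). S \<subseteq> A) \<longleftrightarrow> representable s A B n"
  proof
    assume "\<exists>S\<in>sum_sets (shifts B n). S \<subseteq> A"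
    then obtain S b where S: "S \<subseteq> A" "S \<in> summand_sets s (n - b)" "b \<in> B" "b \<le> n"
      by (auto simp: sum_sets_def shifts_def)
    then have "finite S" "card S = s" "\<Sum>S = n - b" by (auto simp: summand_sets_def)
    then obtain a where a: "bij_betw a {1..s} S" using ex_bij_betw_nat_finite_1 by blast
    then have "(\<Sum>i=1..s. a i) = \<Sum>S" by (rule sum.reindex_bij_betw)
    then show "representable s A B n"
      unfolding representable_def using a S \<open>\<Sum>S = n - b\<close>
      by (intro exI[of _ a] exI[of _ b]) (auto simp: bij_betw_def)
  next
    assume "representable s A B n"
    then obtain a b where a: "\<forall>i\<in>{1..s}. a i \<in> A" "inj_on a {1..s}" "b \<in> B" "n = (\<Sum>i=1..s. a i) + b"
      by (auto simp: representable_def)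
    have "a ` {1..s} \<in> summand_sets s (n - b)"
      using a assms by (auto simp: summand_sets_def card_image sum.reindex)
    then show "\<exists>S\<in>sum_sets (shifts B n). S \<subseteq> A"
      using a by (intro bexI[of _ "a ` {1..s}"]) (auto simp: sum_sets_def shifts_def)
  qed
  then show ?thesis unfolding avoids_def by (intro arg_cong[where f = of_bool]) blast
qed

end

section \<open>Failures up to a bound \<open>N\<close>, and their asymptotics\<close>

context pseudo_power begin

text \<open>The first term of the bound is the number of dependent partners of a failure divided by
  a lower bound for the expected number of failures; the second is the excess correlation left by
  Janson's inequality.\<close>

lemma prob_all_representable_le:
  fixes N N0 :: nat and c :: real
  defines "\<theta> \<equiv> real N powr (- (\<alpha>\<^sup>2 / 4))" and "k \<equiv> c * ln (real N)" and "\<Lambda> \<equiv> lambda_const s"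
  assumes N: "1 \<le> N" and B: "real (counting_fun B N) \<le> k"
    and big: "real N0 + k * (4 * sqrt (real N)) \<le> real N / 2"
  obtains G where "G \<subseteq> {N0<..N}"
    "bern_exp p N (\<lambda>A. of_bool (\<forall>n\<in>G. representable s A B n)) \<le>
      k\<^sup>2 / (real N / 2 * exp (- \<Lambda> * k - 2 * (K * \<theta>) * (\<Lambda> * k))) +
      (exp (12 * real s * K ^ 3 * \<theta> * k\<^sup>2 + 4 * (K * \<theta>) * (\<Lambda> * k)) - 1)"
proof -
  \<comment> \<open>\<open>w\<close> is the cutoff for \<open>pair_weight_le\<close>, and
    \<open>L\<close> is chosen so that \<open>y \<ge> L\<close> forces
    \<open>y - w \<ge> sqrt N\<close>. The overlap terms are then of orders
    \<open>N powr (- \<alpha> * \<alpha> / 4)\<close> and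
    \<open>N powr (\<alpha> / 4 - \<alpha> / 2)\<close>.\<close>
  define w l L where "w = nat \<lceil>real N powr (\<alpha> / 4)\<rceil>" and "l = nat \<lceil>sqrt (real N)\<rceil>" and "L = l + w"
  define \<eta> \<zeta> where "\<eta> = K * \<theta>" and "\<zeta> = 3 * real s * K ^ 3 * \<theta>"
  have K0: "0 \<le> K" using K_ge_1 by linarith
  have \<theta>0: "0 \<le> \<theta>" by (simp add: \<theta>_def)
  have \<eta>0: "0 \<le> \<eta>" and \<zeta>0: "0 \<le> \<zeta>" using K0 \<theta>0 by (auto simp: \<eta>_def \<zeta>_def)
  have \<Lambda>0: "0 \<le> \<Lambda>" using rep_weight_s_le[of 0] rep_weight_nonneg[of s 0] by (simp add: \<Lambda>_def)
  have k0: "0 \<le> k" using B by (rule order.trans[rotated]) simp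
  have pw1: "1 \<le> real N powr (\<alpha> / 4)" using N \<alpha>_pos by (intro ge_one_powr_ge_zero) auto
  have pw2: "real N powr (\<alpha> / 4) \<le> sqrt (real N)"
    using N \<alpha>_le_half unfolding powr_half_sqrt[OF of_nat_0_le_iff, symmetric]
    by (intro powr_mono) auto
  have sq1: "1 \<le> sqrt (real N)" using N by simp
  have w: "real N powr (\<alpha> / 4) \<le> real w" "real w \<le> 2 * real N powr (\<alpha> / 4)" "1 \<le> w"
    using pw1 unfolding w_def by linarith+
  have l: "sqrt (real N) \<le> real l" "real l \<le> sqrt (real N) + 1" "1 \<le> l"
    using sq1 unfolding l_def by linarith+
  have L: "real L \<le> 4 * sqrt (real N)"
    using w l pw2 sq1 unfolding L_def of_nat_add by linarith
  have sqrt_powr: "(sqrt (real N)) powr (- \<alpha>) = real N powr (- (\<alpha> / 2))"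
    using N by (simp add: powr_half_sqrt[symmetric] powr_powr mult.commute)
  \<comment> \<open>Among the decay rates that occur, \<open>\<theta>\<close> is the slowest and
    therefore bounds the others.\<close>
  have exponents: "- (t / 4) \<le> - (t\<^sup>2 / 4) \<and> - (t / 2) \<le> - (t\<^sup>2 / 4)" if "0 < t" "t \<le> 1 / 2" for t :: real
  proof -
    have "t * t \<le> t * 1" using that by (intro mult_left_mono) auto
    then show ?thesis using that by (simp add: power2_eq_square)
  qed
  note \<alpha>_exponents = exponents[OF \<alpha>_pos \<alpha>_le_half]
  have \<eta>: "1 \<le> x \<and> K * real x powr (- \<alpha>) \<le> \<eta>" if "L \<le> x" for x
  proof -
    have "real x powr (- \<alpha>) \<le> (sqrt (real N)) powr (- \<alpha>)"
      using that l N \<alpha>_pos by (intro powr_mono2') (auto simp: L_def)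
    also have "\<dots> = real N powr (- (\<alpha> / 2))" by (rule sqrt_powr)
    also have "\<dots> \<le> \<theta>" unfolding \<theta>_def using N by (intro powr_mono conjunct2[OF \<alpha>_exponents]) simp
    finally have "K * real x powr (- \<alpha>) \<le> \<eta>" unfolding \<eta>_def using K0 by (rule mult_left_mono)
    then show ?thesis using that l by (auto simp: L_def)
  qed
  have \<zeta>: "pair_weight x y \<le> \<zeta>" if "L \<le> y" for x y
  proof -
    have "real w powr (- \<alpha>) \<le> (real N powr (\<alpha> / 4)) powr (- \<alpha>)"
      using N w pw1 \<alpha>_pos by (intro powr_mono2') auto
    also have "\<dots> = \<theta>" by (simp add: \<theta>_def powr_powr power2_eq_square mult_ac)
    finally have 1: "K ^ 2 * real w powr (- \<alpha>) \<le> K ^ 3 * \<theta>"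
      using K_ge_1 \<theta>0 by (intro mult_mono power_increasing) auto
    have "real (y - w) powr (- \<alpha>) \<le> (sqrt (real N)) powr (- \<alpha>)"
      using that l N \<alpha>_pos by (intro powr_mono2') (auto simp: L_def)
    then have "real w * real (y - w) powr (- \<alpha>) \<le> (2 * real N powr (\<alpha> / 4)) * real N powr (- (\<alpha> / 2))"
      unfolding sqrt_powr using w by (intro mult_mono) auto
    also have "\<dots> = 2 * real N powr (- (\<alpha> / 4))" by (simp add: mult.commute flip: powr_add)
    also have "\<dots> \<le> 2 * \<theta>" unfolding \<theta>_def using N by (intro mult_left_mono powr_mono conjunct1[OF \<alpha>_exponents]) simp_all
    finally have 2: "K ^ 3 * (real w * real (y - w) powr (- \<alpha>)) \<le> K ^ 3 * (2 * \<theta>)"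
      using K0 by (intro mult_left_mono) auto
    have "w < y" using that l by (auto simp: L_def)
    have "pair_weight x y \<le> real s * (K ^ 2 * real w powr (- \<alpha>) + K ^ 3 * real w * real (y - w) powr (- \<alpha>))"
      by (rule pair_weight_le) fact+
    also have "\<dots> \<le> real s * (K ^ 3 * \<theta> + K ^ 3 * (2 * \<theta>))"
      using 1 2 by (intro mult_left_mono add_mono) (auto simp: mult.assoc)
    finally show ?thesis by (simp add: \<zeta>_def algebra_simps)
  qed

  define B' where "B' = {b\<in>B. b \<le> N}"
  have B': "finite B'" "real (card B') \<le> k" using B by (auto simp: B'_def counting_fun_def)
  \<comment> \<open>Deleting the \<open>L\<close> integers from each \<open>b\<close> upwards leaves
    only \<open>n\<close> for which every element of \<open>n - B\<close> is at least
    \<open>L\<close>.\<close>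
  define G where "G = {N0<..N} - (\<Union>b\<in>B'. {b..<b + L})"
  define f where "f n = avoids (sum_sets (shifts B n))" for n
  let ?q = "\<lambda>n. bern_exp p N (f n)"
  have G: "G \<subseteq> {N0<..N}" "finite G" by (auto simp: G_def)
  have Z: "shifts B n \<subseteq> {..N}" "finite (shifts B n)" "real (card (shifts B n)) \<le> k" if "n \<in> G" for n
  proof -
    have "n \<le> N" using that G by auto
    show "shifts B n \<subseteq> {..N}" using shifts_subset[of B n] \<open>n \<le> N\<close> by auto
    then show "finite (shifts B n)" using finite_subset by blast
    show "real (card (shifts B n)) \<le> k"
      using counting_fun_mono[OF \<open>n \<le> N\<close>, of B] B by (simp add: card_shifts)
  qed
  have ZL: "L \<le> x" if n: "n \<in> G" and x: "x \<in> shifts B n" for n x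
  proof (rule ccontr)
    assume "\<not> L \<le> x"
    moreover obtain b where "b \<in> B" "b \<le> n" "x = n - b" using x by (auto simp: shifts_def)
    moreover have "n \<le> N" using n G by auto
    ultimately have "b \<in> B'" "n \<in> {b..<b + L}" by (auto simp: B'_def)
    then show False using n by (auto simp: G_def)
  qed
  have lower: "exp (- mean (shifts B n) - 2 * \<eta> * (\<Lambda> * k)) \<le> ?q n" if "n \<in> G" for n
  proof -
    have "\<Lambda> * real (card (shifts B n)) \<le> \<Lambda> * k" using Z(3)[OF that] \<Lambda>0 by (intro mult_left_mono)
    then have "2 * \<eta> * (\<Lambda> * real (card (shifts B n))) \<le> 2 * \<eta> * (\<Lambda> * k)"
      by (rule mult_left_mono) (use \<eta>0 in simp)
    then have "exp (- mean (shifts B n) - 2 * \<eta> * (\<Lambda> * k)) \<le>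
        exp (- mean (shifts B n) - 2 * \<eta> * (\<Lambda> * real (card (shifts B n))))" by simp
    also have "\<dots> \<le> ?q n"
      unfolding f_def \<Lambda>_def using Z[OF that] ZL[OF that] \<eta> \<eta>0 by (intro avoids_sum_sets_lower) auto
    finally show ?thesis .
  qed

  \<comment> \<open>The first summand bounds the overlap over at most \<open>2 * k\<close> targets;
    the second pays for the correction \<open>2 * \<eta> * (\<Lambda> * k)\<close> in each of the
    two single lower bounds.\<close>
  define \<epsilon> where "\<epsilon> = exp (4 * k\<^sup>2 * \<zeta> + 4 * \<eta> * (\<Lambda> * k)) - 1"
  have \<epsilon>0: "0 \<le> \<epsilon>" unfolding \<epsilon>_def using \<zeta>0 \<eta>0 \<Lambda>0 k0 by simp
  have pair: "bern_exp p N (\<lambda>A. f n A * f m A) \<le> (1 + \<epsilon>) * (?q n * ?q m)"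
    if n: "n \<in> G" and m: "m \<in> G" and disj: "\<not> shifts B n \<inter> shifts B m \<noteq> {}" for n m
  proof -
    let ?Z = "shifts B n \<union> shifts B m"
    \<comment> \<open>Disjointness makes the means add, so the leading factor of the joint
      probability splits into the two single ones.\<close>
    have mean: "mean ?Z = mean (shifts B n) + mean (shifts B m)"
      unfolding mean_def using Z n m disj by (intro sum.union_disjoint) auto
    have "real (card ?Z) \<le> 2 * k"
      using card_Un_le[of "shifts B n" "shifts B m"] Z(3)[OF n] Z(3)[OF m] by linarith
    then have card: "real (card ?Z) * real (card ?Z) \<le> (2 * k) * (2 * k)"
      using k0 by (intro mult_mono) auto
    have "(\<Sum>x\<in>?Z. \<Sum>y\<in>?Z. pair_weight x y) \<le> (\<Sum>x\<in>?Z. \<Sum>y\<in>?Z. \<zeta>)"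
      using ZL n m by (intro sum_mono \<zeta>) auto
    also have "\<dots> = real (card ?Z) * real (card ?Z) * \<zeta>" by simp
    also have "\<dots> \<le> (2 * k) * (2 * k) * \<zeta>" using card \<zeta>0 by (rule mult_right_mono)
    finally have pw: "(\<Sum>x\<in>?Z. \<Sum>y\<in>?Z. pair_weight x y) \<le> 4 * k\<^sup>2 * \<zeta>"
      by (simp add: power2_eq_square)
    have "bern_exp p N (\<lambda>A. f n A * f m A) = bern_exp p N (avoids (sum_sets ?Z))"
      by (simp add: f_def sum_sets_Un avoids_Un[abs_def])
    also have "\<dots> \<le> exp (- mean ?Z + (\<Sum>x\<in>?Z. \<Sum>y\<in>?Z. pair_weight x y))"
      using Z n m by (intro avoids_sum_sets_upper) auto
    also have "\<dots> \<le> exp (- mean ?Z + 4 * k\<^sup>2 * \<zeta>)" using pw by simp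
    also have "\<dots> = (1 + \<epsilon>) * (exp (- mean (shifts B n) - 2 * \<eta> * (\<Lambda> * k)) *
        exp (- mean (shifts B m) - 2 * \<eta> * (\<Lambda> * k)))"
      unfolding \<epsilon>_def mean by (simp add: mult_exp_exp)
    also have "\<dots> \<le> (1 + \<epsilon>) * (?q n * ?q m)"
      using lower[OF n] lower[OF m] \<epsilon>0
      by (intro mult_left_mono mult_mono) (auto intro: order.trans[OF exp_ge_zero])
    finally show ?thesis .
  qed

  have few: "real (card {m\<in>G. shifts B n \<inter> shifts B m \<noteq> {}}) \<le> k\<^sup>2" if "n \<in> G" for n
  proof -
    \<comment> \<open>A common element \<open>n - b = m - b'\<close> determines \<open>m\<close>
      from the pair \<open>(b, b')\<close>.\<close>
    have "{m\<in>G. shifts B n \<inter> shifts B m \<noteq> {}} \<subseteq> (\<lambda>(b, b'). n - b + b') ` (B' \<times> B')"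
    proof
      fix m assume "m \<in> {m\<in>G. shifts B n \<inter> shifts B m \<noteq> {}}"
      then obtain b b' where b: "b \<in> B" "b \<le> n" "b' \<in> B" "b' \<le> m" "n - b = m - b'" "m \<in> G"
        by (auto simp: shifts_def)
      then have "b \<in> B'" "b' \<in> B'" "m = n - b + b'" using G that by (auto simp: B'_def)
      then show "m \<in> (\<lambda>(b, b'). n - b + b') ` (B' \<times> B')" by force
    qed
    then have "card {m\<in>G. shifts B n \<inter> shifts B m \<noteq> {}} \<le> card (B' \<times> B')"
      using B' by (meson card_image_le card_mono finite_SigmaI finite_imageI order.trans)
    then have "real (card {m\<in>G. shifts B n \<inter> shifts B m \<noteq> {}}) \<le> real (card B') * real (card B')"
      by (simp add: card_cartesian_product flip: of_nat_mult)
    also have "\<dots> \<le> k * k" using B' k0 by (intro mult_mono) auto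
    finally show ?thesis by (simp add: power2_eq_square)
  qed

  have cardG: "real N / 2 \<le> real (card G)"
  proof -
    have "card (\<Union>b\<in>B'. {b..<b + L}) \<le> (\<Sum>b\<in>B'. card {b..<b + L})" by (rule card_UN_le[OF B'(1)])
    also have "\<dots> = card B' * L" by simp
    finally have "real (card (\<Union>b\<in>B'. {b..<b + L})) \<le> real (card B') * real L"
      by (simp flip: of_nat_mult)
    also have "\<dots> \<le> k * (4 * sqrt (real N))" using B' L k0 by (intro mult_mono) auto
    finally have 1: "real (card (\<Union>b\<in>B'. {b..<b + L})) \<le> k * (4 * sqrt (real N))" .
    have "card {N0<..N} - card (\<Union>b\<in>B'. {b..<b + L}) \<le> card G"
      unfolding G_def using B' by (intro diff_card_le_card_Diff) auto
    then have "real N - real N0 - real (card (\<Union>b\<in>B'. {b..<b + L})) \<le> real (card G)"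
      by simp
    then show ?thesis using 1 big by linarith
  qed
  have "real N / 2 * exp (- \<Lambda> * k - 2 * \<eta> * (\<Lambda> * k)) \<le> real (card G) * exp (- \<Lambda> * k - 2 * \<eta> * (\<Lambda> * k))"
    using cardG by (intro mult_right_mono) auto
  also have "\<dots> \<le> (\<Sum>n\<in>G. ?q n)"
  proof -
    have "exp (- \<Lambda> * k - 2 * \<eta> * (\<Lambda> * k)) \<le> ?q n" if "n \<in> G" for n
    proof -
      have "mean (shifts B n) \<le> \<Lambda> * real (card (shifts B n))" unfolding \<Lambda>_def by (rule mean_le)
      also have "\<dots> \<le> \<Lambda> * k" using Z(3)[OF that] \<Lambda>0 by (intro mult_left_mono)
      finally have "exp (- \<Lambda> * k - 2 * \<eta> * (\<Lambda> * k)) \<le> exp (- mean (shifts B n) - 2 * \<eta> * (\<Lambda> * k))"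
        by simp
      then show ?thesis using lower[OF that] by linarith
    qed
    from sum_mono[of G, OF this] show ?thesis by simp
  qed
  finally have Q: "real N / 2 * exp (- \<Lambda> * k - 2 * \<eta> * (\<Lambda> * k)) \<le> (\<Sum>n\<in>G. ?q n)" .
  have pos: "0 < real N / 2 * exp (- \<Lambda> * k - 2 * \<eta> * (\<Lambda> * k))" using N by simp
  have "bern_exp p N (\<lambda>A. of_bool (\<forall>n\<in>G. representable s A B n)) = bern_exp p N (\<lambda>A. of_bool (\<forall>n\<in>G. f n A = 0))"
  proof (rule bern_exp_cong)
    fix A assume "A \<subseteq> {1..N}"
    then have "0 \<notin> A" by auto
    then show "of_bool (\<forall>n\<in>G. representable s A B n) = (of_bool (\<forall>n\<in>G. f n A = 0) :: real)"
      by (simp add: f_def avoids_shifts)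
  qed
  also have "\<dots> \<le> k\<^sup>2 / (\<Sum>n\<in>G. ?q n) + \<epsilon>"
  proof (rule second_moment[where r = "\<lambda>n m. shifts B n \<inter> shifts B m \<noteq> {}"])
    show "f i A = 0 \<or> f i A = 1" for i A by (auto simp: f_def avoids_def)
    show "0 < (\<Sum>n\<in>G. ?q n)" using Q pos by linarith
  qed (use G pair few \<epsilon>0 in auto)
  also have "k\<^sup>2 / (\<Sum>n\<in>G. ?q n) \<le> k\<^sup>2 / (real N / 2 * exp (- \<Lambda> * k - 2 * \<eta> * (\<Lambda> * k)))"
    using Q pos by (intro divide_left_mono) (auto intro!: mult_pos_pos)
  finally show ?thesis
    using that[OF G(1)] by (simp add: \<epsilon>_def \<eta>_def \<zeta>_def mult_ac)
qed

text \<open>With \<open>k = c * ln N\<close> the factor \<open>exp (- \<Lambda> * k)\<close> is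
  \<open>N powr (- c * \<Lambda>)\<close>. As \<open>c * \<Lambda> < 1\<close>, the expected number
  of failures exceeds a positive power of \<open>N\<close> and outweighs the square of
  \<open>k\<close>, while \<open>\<theta>\<close> times that square tends to 0.\<close>

lemma prob_all_representable_small:
  assumes c: "0 < c" "c * lambda_const s < 1"
    and B: "\<exists>\<^sub>F N in sequentially. real (counting_fun B N) \<le> c * ln (real N)"
    and e: "0 < e"
  obtains N G where "G \<subseteq> {N0<..N}"
    "bern_exp p N (\<lambda>A. of_bool (\<forall>n\<in>G. representable s A B n)) \<le> e"
proof -
  define \<kappa> where "\<kappa> = \<alpha>\<^sup>2 / 4"
  define \<Lambda> where "\<Lambda> = lambda_const s"
  have \<kappa>: "0 < \<kappa>" using \<alpha>_pos unfolding \<kappa>_def by (intro divide_pos_pos zero_less_power) auto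
  have \<Lambda>: "c * \<Lambda> < 1" using c by (simp add: \<Lambda>_def)
  let ?F = "\<lambda>N::nat. (c * ln (real N))\<^sup>2 / (real N / 2 * exp (- \<Lambda> * (c * ln (real N)) -
        2 * (K * real N powr (- \<kappa>)) * (\<Lambda> * (c * ln (real N))))) +
      (exp (12 * real s * K ^ 3 * real N powr (- \<kappa>) * (c * ln (real N))\<^sup>2 +
        4 * (K * real N powr (- \<kappa>)) * (\<Lambda> * (c * ln (real N)))) - 1)"
  have l1: "((\<lambda>N. real N powr (- \<kappa>) * ln (real N)) \<longlongrightarrow> 0) sequentially"
    using \<kappa> by real_asymp
  have l2: "((\<lambda>N. real N powr (- \<kappa>) * (ln (real N))\<^sup>2) \<longlongrightarrow> 0) sequentially"
    using \<kappa> by real_asymp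
  have l3: "((\<lambda>N. (ln (real N))\<^sup>2 * real N powr (- (1 - c * \<Lambda>))) \<longlongrightarrow> 0) sequentially"
    using \<Lambda> by real_asymp
  have a1: "((\<lambda>N. exp ((12 * real s * K ^ 3 * c\<^sup>2) * (real N powr (- \<kappa>) * (ln (real N))\<^sup>2) +
        (4 * K * \<Lambda> * c) * (real N powr (- \<kappa>) * ln (real N))) - 1) \<longlongrightarrow>
      exp ((12 * real s * K ^ 3 * c\<^sup>2) * 0 + (4 * K * \<Lambda> * c) * 0) - 1) sequentially"
    by (intro tendsto_intros l1 l2)
  have a2: "((\<lambda>N. 2 * c\<^sup>2 * ((ln (real N))\<^sup>2 * real N powr (- (1 - c * \<Lambda>))) *
        exp ((2 * K * \<Lambda> * c) * (real N powr (- \<kappa>) * ln (real N)))) \<longlongrightarrow>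
      2 * c\<^sup>2 * 0 * exp ((2 * K * \<Lambda> * c) * 0)) sequentially"
    by (intro tendsto_intros l1 l3)
  have "((\<lambda>N. 2 * c\<^sup>2 * ((ln (real N))\<^sup>2 * real N powr (- (1 - c * \<Lambda>))) *
        exp ((2 * K * \<Lambda> * c) * (real N powr (- \<kappa>) * ln (real N))) +
      (exp ((12 * real s * K ^ 3 * c\<^sup>2) * (real N powr (- \<kappa>) * (ln (real N))\<^sup>2) +
        (4 * K * \<Lambda> * c) * (real N powr (- \<kappa>) * ln (real N))) - 1)) \<longlongrightarrow> 0) sequentially"
    using tendsto_add[OF a2 a1] by simp
  moreover have "\<forall>\<^sub>F N in sequentially. ?F N =
      2 * c\<^sup>2 * ((ln (real N))\<^sup>2 * real N powr (- (1 - c * \<Lambda>))) *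
        exp ((2 * K * \<Lambda> * c) * (real N powr (- \<kappa>) * ln (real N))) +
      (exp ((12 * real s * K ^ 3 * c\<^sup>2) * (real N powr (- \<kappa>) * (ln (real N))\<^sup>2) +
        (4 * K * \<Lambda> * c) * (real N powr (- \<kappa>) * ln (real N))) - 1)"
    using eventually_gt_at_top[of 0]
  proof eventually_elim
    case (elim N)
    have 1: "exp (- \<Lambda> * (c * ln (real N)) - 2 * (K * real N powr (- \<kappa>)) * (\<Lambda> * (c * ln (real N)))) =
      inverse (real N powr (c * \<Lambda>) * exp ((2 * K * \<Lambda> * c) * (real N powr (- \<kappa>) * ln (real N))))"
      using elim by (simp add: powr_def exp_minus[symmetric] exp_add[symmetric] algebra_simps)
    have 2: "real N powr (- (1 - c * \<Lambda>)) = real N powr (c * \<Lambda>) / real N"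
      using elim by (simp add: powr_diff)
    have "(c * ln (real N))\<^sup>2 / (real N / 2 * exp (- \<Lambda> * (c * ln (real N)) -
        2 * (K * real N powr (- \<kappa>)) * (\<Lambda> * (c * ln (real N))))) =
      2 * c\<^sup>2 * ((ln (real N))\<^sup>2 * real N powr (- (1 - c * \<Lambda>))) *
        exp ((2 * K * \<Lambda> * c) * (real N powr (- \<kappa>) * ln (real N)))"
      unfolding 1 2 using elim by (simp add: field_simps power_mult_distrib)
    then show ?case by (simp add: power_mult_distrib mult_ac)
  qed
  ultimately have "(?F \<longlongrightarrow> 0) sequentially"
    by (subst tendsto_cong)
  then have F: "\<forall>\<^sub>F N in sequentially. ?F N < e"
    using e by (rule order_tendstoD)
  have "\<forall>\<^sub>F N in sequentially. real N0 + c * ln (real N) * (4 * sqrt (real N)) \<le> real N / 2"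
    using c(1) by real_asymp
  with F have "\<forall>\<^sub>F N in sequentially. ?F N < e \<and> 1 \<le> N \<and>
      real N0 + c * ln (real N) * (4 * sqrt (real N)) \<le> real N / 2"
    using eventually_ge_at_top[of "1::nat"] by eventually_elim auto
  \<comment> \<open>The counting bound holds for infinitely many \<open>N\<close> and the other
    conditions for all large \<open>N\<close>, so some \<open>N\<close> satisfies them all.\<close>
  from frequently_ex[OF frequently_eventually_frequently[OF B this]] obtain N where
    N: "real (counting_fun B N) \<le> c * ln (real N)" "?F N < e" "1 \<le> N"
      "real N0 + c * ln (real N) * (4 * sqrt (real N)) \<le> real N / 2" by auto
  from prob_all_representable_le[OF N(3) N(1) N(4)] obtain G where
    "G \<subseteq> {N0<..N}" "bern_exp p N (\<lambda>A. of_bool (\<forall>n\<in>G. representable s A B n)) \<le> ?F N"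
    unfolding \<kappa>_def \<Lambda>_def by blast
  then show ?thesis using that N(2) by (meson less_imp_le order.trans)
qed

end

section \<open>Transfer to the probability space\<close>

text \<open>The event is a finite disjoint union of atoms \<open>E S\<close>, one for each possible
  trace of the random set on \<open>{1..N}\<close>, and independence evaluates each atom as a
  product.\<close>

lemma (in prob_space) prob_pseudo_powers_restrict:
  assumes s: "2 \<le> s" and \<xi>: "pseudo_power_vars s \<xi>"
  shows "{\<omega>\<in>space M. \<Phi> (pseudo_powers \<xi> \<omega> \<inter> {1..N})} \<in> events"
    and "prob {\<omega>\<in>space M. \<Phi> (pseudo_powers \<xi> \<omega> \<inter> {1..N})} =
      bern_exp (pseudo_prob s) N (\<lambda>A. of_bool (\<Phi> A))"
proof -
  interpret pp: pseudo_power s by unfold_locales (rule s)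
  let ?p = "pseudo_prob s"
  have indep: "indep_vars (\<lambda>_. count_space UNIV) \<xi> {1..}"
    and dist: "\<And>n. n \<ge> 1 \<Longrightarrow> distr M (count_space UNIV) (\<xi> n) = measure_pmf (bernoulli_pmf (?p n))"
    using \<xi> by (auto simp: pseudo_power_vars_def pseudo_prob_def)
  have meas: "\<xi> n \<in> measurable M (count_space UNIV)" if "n \<ge> 1" for n
    using indep that by (auto simp: indep_vars_def)
  have ev: "\<xi> n -` {b} \<inter> space M \<in> events" if "n \<ge> 1" for n b
    using meas[OF that] by (rule measurable_sets) simp
  have prob1: "prob (\<xi> n -` {b} \<inter> space M) = (if b then ?p n else 1 - ?p n)" if "n \<ge> 1" for n b
  proof -
    have "prob (\<xi> n -` {b} \<inter> space M) = measure (distr M (count_space UNIV) (\<xi> n)) {b}"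
      using meas[OF that] by (simp add: measure_distr)
    also have "\<dots> = pmf (bernoulli_pmf (?p n)) b" unfolding dist[OF that] by (rule measure_pmf_single)
    also have "\<dots> = (if b then ?p n else 1 - ?p n)"
      using pp.p_nonneg[of n] pp.p_le_1[of n] by (cases b) simp_all
    finally show ?thesis .
  qed
  define E where "E S = {\<omega>\<in>space M. pseudo_powers \<xi> \<omega> \<inter> {1..N} = S}" for S
  \<comment> \<open>For \<open>N = 0\<close> the intersection over the empty index set would be the
    whole type rather than \<open>space M\<close>, so that case is separated.\<close>
  have E_eq: "E S = (\<Inter>i\<in>{1..N}. \<xi> i -` {i \<in> S} \<inter> space M)" if "S \<subseteq> {1..N}" "N \<noteq> 0" for S
  proof (rule set_eqI)
    fix \<omega>
    have "i \<in> pseudo_powers \<xi> \<omega> \<inter> {1..N} \<longleftrightarrow> i \<in> {1..N} \<and> \<xi> i \<omega>" for i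
      by (auto simp: pseudo_powers_def)
    then have "pseudo_powers \<xi> \<omega> \<inter> {1..N} = S \<longleftrightarrow> (\<forall>i\<in>{1..N}. \<xi> i \<omega> = (i \<in> S))"
      unfolding set_eq_iff using that(1) by blast
    moreover have "{1..N} \<noteq> {}" using that(2) by simp
    ultimately show "\<omega> \<in> E S \<longleftrightarrow> \<omega> \<in> (\<Inter>i\<in>{1..N}. \<xi> i -` {i \<in> S} \<inter> space M)"
      unfolding E_def by blast
  qed
  have E: "E S \<in> events \<and> prob (E S) = (\<Prod>i\<in>{1..N}. if i \<in> S then ?p i else 1 - ?p i)"
    if S: "S \<subseteq> {1..N}" for S
  proof (cases "N = 0")
    case True
    then have "E S = space M" using S by (auto simp: E_def)
    then show ?thesis using True prob_space by simp
  next
    case False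
    have "prob (E S) = (\<Prod>i\<in>{1..N}. prob (\<xi> i -` {i \<in> S} \<inter> space M))"
      unfolding E_eq[OF S False] by (rule indep_varsD[OF indep]) (use False in auto)
    also have "\<dots> = (\<Prod>i\<in>{1..N}. if i \<in> S then ?p i else 1 - ?p i)"
      by (intro prod.cong refl) (simp add: prob1)
    finally have "prob (E S) = (\<Prod>i\<in>{1..N}. if i \<in> S then ?p i else 1 - ?p i)" .
    moreover have "E S \<in> events"
      unfolding E_eq[OF S False] using False ev by (intro sets.finite_INT) auto
    ultimately show ?thesis by (rule conjI[rotated])
  qed
  have eq: "{\<omega>\<in>space M. \<Phi> (pseudo_powers \<xi> \<omega> \<inter> {1..N})} = (\<Union>S\<in>{S\<in>Pow {1..N}. \<Phi> S}. E S)"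
    unfolding E_def by (intro set_eqI iffI) (simp, elim UN_E CollectE conjE, simp)
  show "{\<omega>\<in>space M. \<Phi> (pseudo_powers \<xi> \<omega> \<inter> {1..N})} \<in> events"
    unfolding eq using E by (intro sets.finite_UN) auto
  have "prob {\<omega>\<in>space M. \<Phi> (pseudo_powers \<xi> \<omega> \<inter> {1..N})} = (\<Sum>S\<in>{S\<in>Pow {1..N}. \<Phi> S}. prob (E S))"
    unfolding eq using E
    by (intro finite_measure_finite_Union) (auto simp: disjoint_family_on_def E_def)
  also have "\<dots> = (\<Sum>S\<in>{S\<in>Pow {1..N}. \<Phi> S}. \<Prod>i\<in>{1..N}. if i \<in> S then ?p i else 1 - ?p i)"
    using E by (intro sum.cong) auto
  also have "\<dots> = bern_exp ?p N (\<lambda>A. of_bool (\<Phi> A))"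
    unfolding bern_exp_eq_sum by (rule sum.mono_neutral_cong_left) auto
  finally show "prob {\<omega>\<in>space M. \<Phi> (pseudo_powers \<xi> \<omega> \<inter> {1..N})} =
      bern_exp ?p N (\<lambda>A. of_bool (\<Phi> A))" .
qed

text \<open>Every summand is positive and at most \<open>n\<close>. This replaces an event about the
  whole random set by one about finitely many coordinates.\<close>

lemma representable_restrict:
  assumes "representable s A B n" "n \<le> N" "0 \<notin> A"
  shows "representable s (A \<inter> {1..N}) B n"
proof -
  obtain a b where a: "\<forall>i\<in>{1..s}. a i \<in> A" "inj_on a {1..s}" "b \<in> B" "n = (\<Sum>i=1..s. a i) + b"
    using assms(1) by (auto simp: representable_def)
  have "a i \<in> A \<inter> {1..N}" if "i \<in> {1..s}" for i
  proof -
    have "a i \<le> (\<Sum>i=1..s. a i)" using that by (intro member_le_sum) auto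
    moreover have "a i \<noteq> 0" using a(1) that assms(3) by metis
    ultimately show ?thesis using a that assms(2) by auto
  qed
  then show ?thesis unfolding representable_def using a by blast
qed

theorem theorem3:
  fixes M :: "'a measure" and \<xi> :: "nat \<Rightarrow> 'a \<Rightarrow> bool"
    and s :: nat and B :: "nat set"
  assumes "prob_space M"
    and "s \<ge> 2"
    and "liminf (\<lambda>n. ereal (real (counting_fun B n) / ln (real n))) < ereal (inverse (lambda_const s))"
    and "prob_space.pseudo_power_vars M s \<xi>"
  shows "AE \<omega> in M. infinite {n. \<not> representable s (pseudo_powers \<xi> \<omega>) B n}"
proof -
  interpret prob_space M by fact
  interpret pp: pseudo_power s by unfold_locales fact
  have \<Lambda>: "0 < lambda_const s"
    unfolding lambda_const_def using pp.\<alpha>_pos \<open>s \<ge> 2\<close>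
    by (intro divide_pos_pos mult_pos_pos zero_less_power Gamma_real_pos) auto
  obtain c0 where c0: "liminf (\<lambda>n. ereal (real (counting_fun B n) / ln (real n))) < ereal c0"
    "c0 < inverse (lambda_const s)"
    using ereal_dense2[OF assms(3)] by auto
  \<comment> \<open>The maximum secures \<open>0 < c\<close> while keeping
    \<open>c0 \<le> c < inverse (lambda_const s)\<close>.\<close>
  define c where "c = max c0 (inverse (lambda_const s) / 2)"
  have c: "0 < c" "c < inverse (lambda_const s)"
    using \<Lambda> c0(2) by (auto simp: c_def less_max_iff_disj)
  have c\<Lambda>: "c * lambda_const s < 1"
    using c(2) \<Lambda> by (simp add: field_simps)
  \<comment> \<open>Otherwise the quotient would eventually be at least \<open>c0\<close>, and so
    would its lower limit. Dividing by \<open>ln N\<close> requires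
    \<open>N \<ge> 2\<close>.\<close>
  have freq: "\<exists>\<^sub>F N in sequentially. real (counting_fun B N) \<le> c * ln (real N)"
  proof (rule ccontr)
    assume "\<not> ?thesis"
    then have "\<forall>\<^sub>F N in sequentially. \<not> real (counting_fun B N) \<le> c * ln (real N)"
      by (simp add: not_frequently)
    then have "\<forall>\<^sub>F N in sequentially. ereal c0 \<le> ereal (real (counting_fun B N) / ln (real N))"
      using eventually_ge_at_top[of "2::nat"]
    proof eventually_elim
      case (elim N)
      have "0 < ln (real N)" using elim(2) by simp
      then have "c \<le> real (counting_fun B N) / ln (real N)" using elim(1) by (simp add: field_simps)
      then show ?case by (simp add: c_def)
    qed
    from Liminf_bounded[OF this] c0(1) show False by simp
  qed
  have "AE \<omega> in M. \<not> (\<forall>n>N0. representable s (pseudo_powers \<xi> \<omega>) B n)" for N0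
  proof -
    \<comment> \<open>\<open>H\<close> constrains infinitely many \<open>n\<close>. It is covered by
      events of arbitrarily small probability, each about finitely many coordinates, whose
      intersection is null.\<close>
    define H where "H = {\<omega>\<in>space M. \<forall>n>N0. representable s (pseudo_powers \<xi> \<omega>) B n}"
    have "\<exists>F. F \<in> events \<and> H \<subseteq> F \<and> prob F \<le> 1 / real (Suc j)" for j
    proof -
      have e: "0 < 1 / real (Suc j)" by simp
      obtain N G where G: "G \<subseteq> {N0<..N}"
        "bern_exp (pseudo_prob s) N (\<lambda>A. of_bool (\<forall>n\<in>G. representable s A B n)) \<le> 1 / real (Suc j)"
        by (rule pp.prob_all_representable_small[OF c(1) c\<Lambda> freq e])
      let ?F = "{\<omega>\<in>space M. \<forall>n\<in>G. representable s (pseudo_powers \<xi> \<omega> \<inter> {1..N}) B n}"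
      have "H \<subseteq> ?F"
      proof (intro subsetI CollectI conjI ballI)
        fix \<omega> n assume \<omega>: "\<omega> \<in> H" and "n \<in> G"
        then have "N0 < n" "n \<le> N" using G(1) by auto
        then show "representable s (pseudo_powers \<xi> \<omega> \<inter> {1..N}) B n"
          using \<omega> by (intro representable_restrict) (auto simp: H_def pseudo_powers_def)
      qed (auto simp: H_def)
      then show ?thesis
        using prob_pseudo_powers_restrict[OF assms(2,4),
            of "\<lambda>A. \<forall>n\<in>G. representable s A B n" N] G(2)
        by (intro exI[of _ ?F]) auto
    qed
    then have "\<exists>F. \<forall>j. F j \<in> events \<and> H \<subseteq> F j \<and> prob (F j) \<le> 1 / real (Suc j)"
      by (intro choice) blast
    then obtain F where F: "\<And>j. F j \<in> events" "\<And>j. H \<subseteq> F j" "\<And>j. prob (F j) \<le> 1 / real (Suc j)"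
      by blast
    have "prob (\<Inter>j. F j) \<le> 1 / real (Suc j)" for j
      using F by (intro order.trans[OF finite_measure_mono F(3)[of j]]) auto
    then have le: "prob (\<Inter>j. F j) \<le> 0"
      by (intro LIMSEQ_le_const[OF LIMSEQ_inverse_real_of_nat]) (auto simp: inverse_eq_divide)
    have "emeasure M (\<Inter>j. F j) = 0"
      using antisym[OF le measure_nonneg] by (simp add: emeasure_eq_measure)
    then show ?thesis
      using F(1,2) by (intro AE_I[where N = "\<Inter>j. F j"]) (auto simp: H_def)
  qed
  \<comment> \<open>Only countably many thresholds \<open>N0\<close> occur, so the null sets
    combine; failures beyond every threshold form an infinite set.\<close>
  then have "AE \<omega> in M. \<forall>N0. \<not> (\<forall>n>N0. representable s (pseudo_powers \<xi> \<omega>) B n)"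
    unfolding AE_all_countable by (intro allI)
  then show ?thesis
  proof eventually_elim
    case (elim \<omega>)
    then show ?case unfolding infinite_nat_iff_unbounded by blast
  qed
qed

end
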